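(* Let $m\geq 0$ be an integer. For $v\in H_0^m$ put \[ c_{sh}(v):=-\operatorname{artanh}\left(\frac{\int_{\mathbb T}\sinh(2\partial_x^{-1}v)\,dx}{\int_{\mathbb T}\cosh(2\partial_x^{-1}v)\,dx}\right),\qquad \Psi_{sh}(v):=2\partial_x^{-1}v+c_{sh}(v). \] Then: (i) $c_{sh}$ is well defined, and $\Psi_{sh}$ is a real analytic diffeomorphism from $H_0^m$ onto \[ M^{m+1}_{sh}:=\Big\{u\in H^{m+1}:\ \int_{\mathbb T}\sinh(u)\,dx=0\Big\}. \] Moreover, $\Psi_{sh}$ transforms the sinh-Gordon equation $u_{xt}=\sinh(u)$ into the equation \[ v_t=\tfrac12\sinh\big(2\partial_x^{-1}v+c_{sh}(v)\big) \] on $H_0^m$: a $C^1$ curve $t\mapsto v(t)$ in $H_0^m$ solves this equation if and only if $u(t)=\Psi_{sh}(v(t))$ solves $u_{xt}=\sinh(u)$. The vector field $v\mapsto \tfrac12\sinh(2\partial_x^{-1}v+c_{sh}(v))$ takes values in $H_0^{m+1}$. (ii) This equation is a Hamiltonian PDE with respect to the Gardner bracket, with Hamiltonian \[ H_{sh}:H_0^m\to\mathbb R,\qquad H_{sh}(v)=-\tfrac14\int_{\mathbb T}\cosh\big(2\partial_x^{-1}v+c_{sh}(v)\big)\,dx. \] That is, $\partial_x\nabla H_{sh}(v)=\tfrac12\sinh(2\partial_x^{-1}v+c_{sh}(v))$ for all $v\in H_0^m$.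
   Context: $\mathbb T=\mathbb R/\mathbb Z$, and $H^m=H^m(\mathbb T,\mathbb R)$ denotes the real Sobolev space. Further, $H_0^m=\{u\in H^m:\int_{\mathbb T}u\,dx=0\}$, and $\partial_x^{-1}$ is the mean-zero antiderivative, i.e. for $v\in H_0^m$, $\partial_x^{-1}v$ is the unique element of $H_0^{m+1}$ whose $x$-derivative is $v$. The Gardner bracket of $C^1$ functionals $F,G$ on $H_0^m$ with $L^2$-gradients in $H^1$ is $\{F,G\}(v)=\int_0^1\nabla F\,\partial_x\nabla G\,dx$. Correspondingly, the Hamiltonian vector field of $H$ is $\partial_x\nabla H$, where $\nabla H(v)$ is the $L^2$-gradient, i.e. $dH(v)[h]=\int_{\mathbb T}\nabla H(v)\,h\,dx$ for all $h\in H_0^m$. Since $\nabla H(v)$ is determined only up to an additive constant, $\partial_x\nabla H(v)$ is well defined. *)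

theory Defs
  imports "HOL-Analysis.Analysis"
begin

text \<open>Elements of the real Sobolev spaces H^m on T = R/Z are represented by their
Fourier coefficient sequences c :: int => complex, with u(x) = sum_k c_k e^{2 pi i k x}.
Real-valuedness is the symmetry c(-k) = cnj (c k).\<close>

type_synonym fseq = "int \<Rightarrow> complex"

definition real_seq :: "fseq \<Rightarrow> bool" where
  "real_seq c \<longleftrightarrow> (\<forall>k. c (- k) = cnj (c k))"

definition sob_weight :: "nat \<Rightarrow> int \<Rightarrow> real" where
  "sob_weight m k = (1 + (real_of_int k)\<^sup>2) ^ m"

definition Hs :: "nat \<Rightarrow> fseq set" where
  "Hs m = {c. real_seq c \<and> (\<lambda>k. sob_weight m k * (cmod (c k))\<^sup>2) summable_on UNIV}"

definition Hs0 :: "nat \<Rightarrow> fseq set" where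
  "Hs0 m = {c \<in> Hs m. c 0 = 0}"

definition hnorm :: "nat \<Rightarrow> fseq \<Rightarrow> real" where
  "hnorm m c = sqrt (infsum (\<lambda>k. sob_weight m k * (cmod (c k))\<^sup>2) UNIV)"

definition sadd :: "fseq \<Rightarrow> fseq \<Rightarrow> fseq" where
  "sadd c d = (\<lambda>k. c k + d k)"

definition ssub :: "fseq \<Rightarrow> fseq \<Rightarrow> fseq" where
  "ssub c d = (\<lambda>k. c k - d k)"

definition sscale :: "real \<Rightarrow> fseq \<Rightarrow> fseq" where
  "sscale a c = (\<lambda>k. complex_of_real a * c k)"

text \<open>The function represented by a coefficient sequence (used for sequences in H^1,
where the Fourier series converges absolutely)\<close>
definition fseries :: "fseq \<Rightarrow> real \<Rightarrow> real" where
  "fseries c x = Re (infsum (\<lambda>k. c k * cis (2 * pi * real_of_int k * x)) UNIV)"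

definition fcoef :: "(real \<Rightarrow> real) \<Rightarrow> fseq" where
  "fcoef f k = integral {0..1} (\<lambda>x. complex_of_real (f x) * cis (- (2 * pi * real_of_int k * x)))"

definition intT :: "(real \<Rightarrow> real) \<Rightarrow> real" where
  "intT f = integral {0..1} f"

definition antider :: "fseq \<Rightarrow> fseq" where
  "antider c k = (if k = 0 then 0 else c k / (2 * complex_of_real pi * \<i> * of_int k))"

definition dx :: "fseq \<Rightarrow> fseq" where
  "dx c k = 2 * complex_of_real pi * \<i> * of_int k * c k"

text \<open>L^2 pairing int_T g h dx of real functions, via Parseval\<close>
definition l2pair :: "fseq \<Rightarrow> fseq \<Rightarrow> real" where
  "l2pair g h = Re (infsum (\<lambda>k. g k * cnj (h k)) UNIV)"

definition c_sh :: "fseq \<Rightarrow> real" where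
  "c_sh v = - artanh (intT (\<lambda>x. sinh (2 * fseries (antider v) x))
                     / intT (\<lambda>x. cosh (2 * fseries (antider v) x)))"

definition Psi_sh :: "fseq \<Rightarrow> fseq" where
  "Psi_sh v = (\<lambda>k. 2 * antider v k + (if k = 0 then complex_of_real (c_sh v) else 0))"

definition M_sh :: "nat \<Rightarrow> fseq set" where
  "M_sh m = {u \<in> Hs m. intT (\<lambda>x. sinh (fseries u x)) = 0}"

definition sinh_seq :: "fseq \<Rightarrow> fseq" where
  "sinh_seq u = fcoef (\<lambda>x. sinh (fseries u x))"

definition X_sh :: "fseq \<Rightarrow> fseq" where
  "X_sh v = fcoef (\<lambda>x. sinh (fseries (Psi_sh v) x) / 2)"

definition H_sh :: "fseq \<Rightarrow> real" where
  "H_sh v = - 1 / 4 * intT (\<lambda>x. cosh (fseries (Psi_sh v) x))"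

definition mlin_bounded ::
  "fseq set \<Rightarrow> nat \<Rightarrow> nat \<Rightarrow> nat \<Rightarrow> ((nat \<Rightarrow> fseq) \<Rightarrow> fseq) \<Rightarrow> real \<Rightarrow> bool" where
  "mlin_bounded E m n j A C \<longleftrightarrow>
     (\<forall>hs. (\<forall>i<j. hs i \<in> E) \<longrightarrow>
            A hs \<in> Hs n \<and> hnorm n (A hs) \<le> C * (\<Prod>i<j. hnorm m (hs i))) \<and>
     (\<forall>hs i x y a b. (\<forall>l<j. hs l \<in> E) \<longrightarrow> i < j \<longrightarrow> x \<in> E \<longrightarrow> y \<in> E \<longrightarrow>
         A (hs(i := sadd (sscale a x) (sscale b y)))
           = sadd (sscale a (A (hs(i := x)))) (sscale b (A (hs(i := y))))) \<and>
     (\<forall>hs hs'. (\<forall>i<j. hs i = hs' i) \<longrightarrow> A hs = A hs')"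

definition analytic_at :: "fseq set \<Rightarrow> nat \<Rightarrow> nat \<Rightarrow> (fseq \<Rightarrow> fseq) \<Rightarrow> fseq \<Rightarrow> bool" where
  "analytic_at E m n F p \<longleftrightarrow>
     (\<exists>r>0. \<exists>A C. (\<forall>j. mlin_bounded E m n j (A j) (C j)) \<and> summable (\<lambda>j. C j * r ^ j) \<and>
        (\<forall>h\<in>E. hnorm m h < r \<longrightarrow>
           ((\<lambda>N. hnorm n (\<lambda>k. F (sadd p h) k - (\<Sum>j<N. A j (\<lambda>_. h) k))) \<longlonglongrightarrow> 0)))"

definition hopen :: "nat \<Rightarrow> fseq set \<Rightarrow> fseq set \<Rightarrow> bool" where
  "hopen m E W \<longleftrightarrow> W \<subseteq> E \<and> (\<forall>p\<in>W. \<exists>r>0. \<forall>q\<in>E. hnorm m (ssub q p) < r \<longrightarrow> q \<in> W)"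

definition analytic_diffeo_onto ::
  "fseq set \<Rightarrow> nat \<Rightarrow> nat \<Rightarrow> (fseq \<Rightarrow> fseq) \<Rightarrow> fseq set \<Rightarrow> bool" where
  "analytic_diffeo_onto E m n F M \<longleftrightarrow>
     bij_betw F E M \<and> M \<subseteq> Hs n \<and> (\<forall>p\<in>E. analytic_at E m n F p) \<and>
     (\<exists>W G. M \<subseteq> W \<and> hopen n (Hs n) W \<and> (\<forall>q\<in>W. analytic_at (Hs n) n m G q) \<and>
            (\<forall>u\<in>M. G u = the_inv_into E F u))"

definition has_hderiv :: "nat \<Rightarrow> (real \<Rightarrow> fseq) \<Rightarrow> fseq \<Rightarrow> real \<Rightarrow> bool" where
  "has_hderiv m \<gamma> d t \<longleftrightarrow>
     ((\<lambda>s. hnorm m (\<lambda>k. (\<gamma> s k - \<gamma> t k) / complex_of_real (s - t) - d k)) \<longlongrightarrow> 0) (at t)"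

definition C1_curve :: "fseq set \<Rightarrow> nat \<Rightarrow> (real \<Rightarrow> fseq) \<Rightarrow> real \<Rightarrow> real \<Rightarrow> bool" where
  "C1_curve E m \<gamma> a b \<longleftrightarrow>
     (\<forall>t\<in>{a<..<b}. \<gamma> t \<in> E) \<and>
     (\<exists>\<gamma>'. (\<forall>t\<in>{a<..<b}. \<gamma>' t \<in> Hs m \<and> has_hderiv m \<gamma> (\<gamma>' t) t) \<and>
           (\<forall>t\<in>{a<..<b}. ((\<lambda>s. hnorm m (ssub (\<gamma>' s) (\<gamma>' t))) \<longlongrightarrow> 0) (at t within {a<..<b})))"

definition solves_vsh :: "nat \<Rightarrow> (real \<Rightarrow> fseq) \<Rightarrow> real \<Rightarrow> real \<Rightarrow> bool" where
  "solves_vsh m v a b \<longleftrightarrow> (\<forall>t\<in>{a<..<b}. v t \<in> Hs0 m \<and> has_hderiv m v (X_sh (v t)) t)"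

definition solves_SG :: "nat \<Rightarrow> (real \<Rightarrow> fseq) \<Rightarrow> real \<Rightarrow> real \<Rightarrow> bool" where
  "solves_SG m u a b \<longleftrightarrow>
     (\<forall>t\<in>{a<..<b}. u t \<in> Hs (m + 1) \<and>
        (\<exists>w\<in>Hs (m + 1). has_hderiv (m + 1) u w t \<and> dx w = sinh_seq (u t)))"

definition has_L2grad :: "fseq set \<Rightarrow> nat \<Rightarrow> (fseq \<Rightarrow> real) \<Rightarrow> fseq \<Rightarrow> fseq \<Rightarrow> bool" where
  "has_L2grad E m Hf v g \<longleftrightarrow>
     (\<forall>\<epsilon>>0. \<exists>\<delta>>0. \<forall>h\<in>E. hnorm m h < \<delta> \<longrightarrow>
        \<bar>Hf (sadd v h) - Hf v - l2pair g h\<bar> \<le> \<epsilon> * hnorm m h)"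

end

theory Submission
  imports Defs
begin

text \<open>
  Write w for the mean-zero antiderivative of v, and P, Q for the integrals of exp (2 w) and
  exp (- 2 w) over the circle. The mean of sinh (2 w + c) is (e^c P - e^{-c} Q) / 2, which vanishes
  for exactly one c, namely c = (ln Q - ln P) / 2, and this is the normalizing constant of v.
  Hence the map is a bijection onto the constraint set, with inverse u \<mapsto> u_x / 2, which is
  bounded linear on the whole Sobolev space; the Hamiltonian is - (P Q)^{1/2} / 4.

  Analyticity thus reduces to that of ln P and ln Q. The Taylor terms of P at v are explicit
  multilinear forms, and those of ln P are obtained from them by the recursion expressing
  P (ln P)' = P', which keeps them multilinear and geometrically bounded.

  That sinh u stays in the Sobolev space of u follows from the algebra property: convolution with
  weights bounded by Young's inequality, applied to the partial sums of the exponential series,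
  whose coefficients converge while their norms stay bounded.
\<close>

subsection \<open>Sobolev norms of coefficient sequences\<close>

text \<open>The constraint is solved globally, so no implicit function theorem enters: the inverse
  extends to all of \<open>Hs (m + 1)\<close>, and that whole space serves as the open neighbourhood
  on which it is analytic. The obstacle is that \<open>analytic_at\<close> asks for multilinear
  forms on tuples of arguments, not only for a power series along each ray. Composing with
  \<open>ln\<close> would mean substituting one series into another; the recursion avoids this,
  because each of its terms is a product of two forms that read consecutive blocks of arguments. The
  identity left to prove concerns a single h and is one about real power series: a parameter x turns
  the recursion into an ordinary differential equation. Analysis is done on \<open>Hs m\<close>,
  since \<open>antider\<close> discards the zero mode, and is restricted to \<open>Hs0 m\<close> at
  the end. For the two evolution equations, the nonlinearity of the transformation sits in one
  scalar, the zero mode of u. Differentiation in x removes it, so one direction applies a bounded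
  linear map and the other only needs this scalar to be differentiable in t.\<close>

definition hpart :: "nat \<Rightarrow> fseq \<Rightarrow> int set \<Rightarrow> real" where
  "hpart s c F = L2_set (\<lambda>k. sqrt (sob_weight s k) * cmod (c k)) F"

text \<open>Since infinite sums that do not converge are 0, so is the norm of a sequence outside the
  Sobolev space; estimates of norms therefore carry the following finiteness hypothesis.\<close>

definition hfin :: "nat \<Rightarrow> fseq \<Rightarrow> bool" where
  "hfin s c \<longleftrightarrow> (\<lambda>k. sob_weight s k * (cmod (c k))\<^sup>2) summable_on UNIV"

lemma sob_weight_pos: "sob_weight s k > 0"
  unfolding sob_weight_def by (simp add: add_pos_nonneg)

lemma sob_weight_nonneg [simp]: "sob_weight s k \<ge> 0"
  using sob_weight_pos[of s k] by simp

lemma sob_weight_zero [simp]: "sob_weight s 0 = 1"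
  by (simp add: sob_weight_def)

lemma sob_weight_uminus [simp]: "sob_weight s (- k) = sob_weight s k"
  by (simp add: sob_weight_def)

lemma sob_weight_mono: "s \<le> s' \<Longrightarrow> sob_weight s k \<le> sob_weight s' k"
  unfolding sob_weight_def by (rule power_increasing) auto

lemma hpart_sq: "(hpart s c F)\<^sup>2 = (\<Sum>k\<in>F. sob_weight s k * (cmod (c k))\<^sup>2)"
  unfolding hpart_def L2_set_def by (simp add: sum_nonneg power_mult_distrib)

lemma hpart_nonneg [simp]: "hpart s c F \<ge> 0"
  by (simp add: hpart_def)

lemma hnorm_nonneg [simp]: "hnorm s c \<ge> 0"
  unfolding hnorm_def by (intro real_sqrt_ge_zero infsum_nonneg) auto

lemma hpart_le_hnorm:
  assumes "hfin s c" "finite F"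
  shows "hpart s c F \<le> hnorm s c"
proof -
  have "(hpart s c F)\<^sup>2 \<le> infsum (\<lambda>k. sob_weight s k * (cmod (c k))\<^sup>2) UNIV"
    unfolding hpart_sq using assms by (intro finite_sum_le_infsum) (auto simp: hfin_def)
  thus ?thesis unfolding hnorm_def by (intro real_le_rsqrt)
qed

text \<open>Estimates are made on finite sets of frequencies, where the \<open>L2_set\<close>
  inequalities apply without summability conditions; exhaustion turns a uniform bound into both
  finiteness and a norm bound. The empty set supplies \<open>B \<ge> 0\<close>.\<close>

lemma
  assumes "\<And>F. finite F \<Longrightarrow> hpart s c F \<le> B"
  shows hfin_boundedI: "hfin s c" and hnorm_leI: "hnorm s c \<le> B"
proof -
  have B: "B \<ge> 0" using assms[of "{}"] by (simp add: hpart_def)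
  have b: "(\<Sum>k\<in>F. sob_weight s k * (cmod (c k))\<^sup>2) \<le> B\<^sup>2" if "finite F" for F
    unfolding hpart_sq[symmetric] using assms[OF that] by (intro power_mono) auto
  show h: "hfin s c"
    unfolding hfin_def using b
    by (intro nonneg_bdd_above_summable_on) (auto simp: bdd_above_def)
  have "infsum (\<lambda>k. sob_weight s k * (cmod (c k))\<^sup>2) UNIV \<le> B\<^sup>2"
    using h b unfolding hfin_def by (intro infsum_le_finite_sums) auto
  thus "hnorm s c \<le> B" unfolding hnorm_def using B by (intro real_le_lsqrt) auto
qed

lemma hpart_add: "hpart s (\<lambda>k. c k + d k) F \<le> hpart s c F + hpart s d F"
proof -
  have "hpart s (\<lambda>k. c k + d k) F
      \<le> L2_set (\<lambda>k. sqrt (sob_weight s k) * cmod (c k) + sqrt (sob_weight s k) * cmod (d k)) F"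
    unfolding hpart_def
    by (intro L2_set_mono)
       (simp_all flip: distrib_left add: mult_left_mono norm_triangle_ineq)
  also have "\<dots> \<le> hpart s c F + hpart s d F"
    unfolding hpart_def by (rule L2_set_triangle_ineq)
  finally show ?thesis .
qed

lemma hpart_mono:
  assumes "\<And>k. sqrt (sob_weight s k) * cmod (c k) \<le> B * (sqrt (sob_weight s' k) * cmod (d k))" "B \<ge> 0"
  shows "hpart s c F \<le> B * hpart s' d F"
  unfolding hpart_def using assms by (subst L2_set_right_distrib) (auto intro!: L2_set_mono)

lemma
  assumes "hfin s c" "hfin s d"
  shows hfin_add: "hfin s (\<lambda>k. c k + d k)"
    and hnorm_add: "hnorm s (\<lambda>k. c k + d k) \<le> hnorm s c + hnorm s d"
proof -
  have "hpart s (\<lambda>k. c k + d k) F \<le> hnorm s c + hnorm s d" if "finite F" for F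
    using hpart_add[of s c d F] hpart_le_hnorm[OF assms(1) that] hpart_le_hnorm[OF assms(2) that]
    by linarith
  from hfin_boundedI[OF this] hnorm_leI[OF this]
  show "hfin s (\<lambda>k. c k + d k)" "hnorm s (\<lambda>k. c k + d k) \<le> hnorm s c + hnorm s d" by blast+
qed

text \<open>A Fourier multiplier whose symbol is controlled by the ratio of the weights is bounded
  from order \<open>s'\<close> to order \<open>s\<close>. Scaling, lowering the order,
  \<open>antider\<close> and \<open>dx\<close> are all instances.\<close>

lemma
  assumes "hfin s' d" "B \<ge> 0"
    and "\<And>k. sqrt (sob_weight s k) * cmod (c k) \<le> B * (sqrt (sob_weight s' k) * cmod (d k))"
  shows hfin_dominated: "hfin s c"
    and hnorm_dominated: "hnorm s c \<le> B * hnorm s' d"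
proof -
  have "hpart s c F \<le> B * hnorm s' d" if "finite F" for F
    using hpart_mono[OF assms(3) assms(2), of F] hpart_le_hnorm[OF assms(1) that] assms(2)
    by (meson mult_left_mono order_trans)
  from hfin_boundedI[OF this] hnorm_leI[OF this]
  show "hfin s c" "hnorm s c \<le> B * hnorm s' d" by blast+
qed

lemma hfin_scale: "hfin s c \<Longrightarrow> hfin s (\<lambda>k. a * c k)"
  by (rule hfin_dominated[of s c "cmod a"]) (auto simp: norm_mult)

lemma hnorm_scale: "hnorm s (\<lambda>k. a * c k) = cmod a * hnorm s c"
proof -
  have "infsum (\<lambda>k. sob_weight s k * (cmod (a * c k))\<^sup>2) UNIV
      = infsum (\<lambda>k. (cmod a)\<^sup>2 * (sob_weight s k * (cmod (c k))\<^sup>2)) UNIV"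
    by (intro infsum_cong) (auto simp: norm_mult power_mult_distrib)
  also have "\<dots> = (cmod a)\<^sup>2 * infsum (\<lambda>k. sob_weight s k * (cmod (c k))\<^sup>2) UNIV"
    by (rule infsum_cmult_right')
  finally show ?thesis unfolding hnorm_def by (simp add: real_sqrt_mult)
qed

lemma hfin_uminus: "hfin s c \<Longrightarrow> hfin s (\<lambda>k. - c k)"
  using hfin_scale[of s c "-1"] by simp

lemma hfin_diff: "hfin s c \<Longrightarrow> hfin s d \<Longrightarrow> hfin s (\<lambda>k. c k - d k)"
  using hfin_add[OF _ hfin_uminus, of s c d] by simp

lemma hnorm_zero [simp]: "hnorm s (\<lambda>k. 0) = 0"
  by (simp add: hnorm_def)

lemma hfin_zero [simp]: "hfin s (\<lambda>k. 0)"
  by (simp add: hfin_def)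

lemma hfin_order_mono: "hfin s' c \<Longrightarrow> s \<le> s' \<Longrightarrow> hfin s c"
  by (rule hfin_dominated[of s' c 1]) (auto intro!: mult_right_mono sob_weight_mono)

lemma hnorm_order_mono: "hfin s' c \<Longrightarrow> s \<le> s' \<Longrightarrow> hnorm s c \<le> hnorm s' c"
  using hnorm_dominated[of s' c 1 s c] by (simp add: mult_right_mono sob_weight_mono)

lemma hfin_single: "hfin s (\<lambda>k. if k = 0 then a else 0)"
  and hnorm_single: "hnorm s (\<lambda>k. if k = 0 then a else 0) = cmod a"
proof -
  have "((\<lambda>k. sob_weight s k * (cmod (if k = 0 then a else 0))\<^sup>2) has_sum (cmod a)\<^sup>2) UNIV"
    by (rule has_sum_finite_neutralI[of "{0}"]) auto
  thus "hfin s (\<lambda>k. if k = 0 then a else 0)"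
    "hnorm s (\<lambda>k. if k = 0 then a else 0) = cmod a"
    unfolding hfin_def hnorm_def by (auto simp: has_sum_iff)
qed

lemma Hs_iff: "c \<in> Hs s \<longleftrightarrow> real_seq c \<and> hfin s c"
  by (simp add: Hs_def hfin_def)

lemma Hs0_iff: "c \<in> Hs0 s \<longleftrightarrow> real_seq c \<and> hfin s c \<and> c 0 = 0"
  by (simp add: Hs0_def Hs_iff)

subsection \<open>Absolutely convergent Fourier series\<close>

text \<open>Comparison with the sum of 1/n^2 on the two half-lines. This is the l^2 factor in the
  Cauchy-Schwarz argument for the embedding of H^1.\<close>

lemma sob_weight_inverse_summable: "(\<lambda>k. 1 / sob_weight 1 k) summable_on UNIV"
proof -
  have s: "summable (\<lambda>n. 1 / (1 + (real n)\<^sup>2))"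
  proof (rule summable_comparison_test')
    show "summable (\<lambda>n. inverse ((real n)\<^sup>2))"
      by (rule inverse_power_summable) simp
    fix n :: nat assume "n \<ge> 1"
    thus "norm (1 / (1 + (real n)\<^sup>2)) \<le> inverse ((real n)\<^sup>2)"
      by (simp add: inverse_eq_divide frac_le add_nonneg_nonneg)
  qed
  hence n: "(\<lambda>n. 1 / (1 + (real n)\<^sup>2)) summable_on UNIV"
    by (intro summable_nonneg_imp_summable_on) auto
  have p: "(\<lambda>k. 1 / sob_weight 1 k) summable_on range int"
    by (subst summable_on_reindex) (use n in \<open>auto simp: sob_weight_def o_def\<close>)
  have m: "(\<lambda>k. 1 / sob_weight 1 k) summable_on range (\<lambda>n. - int n)"
    by (subst summable_on_reindex) (use n in \<open>auto simp: sob_weight_def o_def inj_def\<close>)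
  have "k \<in> range int \<union> range (\<lambda>n. - int n)" for k
    by (cases k rule: int_cases2) auto
  hence "(UNIV :: int set) = range int \<union> range (\<lambda>n. - int n)" by blast
  with summable_on_union[OF p m] show ?thesis by simp
qed

text \<open>The l^2 norm of (1 + k^2)^(-1/2), which is the constant in the embedding of H^1 into the
  absolutely convergent Fourier series.\<close>

definition embed_const :: real where
  "embed_const = sqrt (infsum (\<lambda>k. 1 / sob_weight 1 k) UNIV)"

lemma embed_const_nonneg: "embed_const \<ge> 0"
  unfolding embed_const_def by (intro real_sqrt_ge_zero infsum_nonneg) auto

text \<open>Cauchy-Schwarz, with the root of the weight of order 1 divided out of one factor and put
  into the other. Higher orders reduce to order 1 by monotonicity of the norm.\<close>

lemma
  assumes "hfin s c" "s \<ge> 1"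
  shows hfin_abs_summable: "(\<lambda>k. cmod (c k)) summable_on UNIV"
    and infsum_norm_le_hnorm: "infsum (\<lambda>k. cmod (c k)) UNIV \<le> embed_const * hnorm s c"
proof -
  have h1: "hfin 1 c" "hnorm 1 c \<le> hnorm s c"
    using assms hfin_order_mono hnorm_order_mono by auto
  have b: "(\<Sum>k\<in>F. cmod (c k)) \<le> embed_const * hnorm s c" if "finite F" for F
  proof -
    have "(\<Sum>k\<in>F. cmod (c k))
        = (\<Sum>k\<in>F. \<bar>1 / sqrt (sob_weight 1 k)\<bar> * \<bar>sqrt (sob_weight 1 k) * cmod (c k)\<bar>)"
      using sob_weight_pos[of 1, THEN less_imp_neq] by (simp add: abs_mult)
    also have "\<dots> \<le> L2_set (\<lambda>k. 1 / sqrt (sob_weight 1 k)) F * hpart 1 c F"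
      unfolding hpart_def by (rule L2_set_mult_ineq)
    also have "\<dots> \<le> embed_const * hnorm s c"
    proof (intro mult_mono embed_const_nonneg hpart_nonneg)
      show "L2_set (\<lambda>k. 1 / sqrt (sob_weight 1 k)) F \<le> embed_const"
        unfolding L2_set_def embed_const_def using that sob_weight_inverse_summable
        by (auto simp: power_divide intro!: finite_sum_le_infsum)
      show "hpart 1 c F \<le> hnorm s c"
        using hpart_le_hnorm[OF h1(1) that] h1(2) by linarith
    qed
    finally show ?thesis .
  qed
  show "(\<lambda>k. cmod (c k)) summable_on UNIV"
    using b by (intro nonneg_bdd_above_summable_on) (auto simp: bdd_above_def)
  thus "infsum (\<lambda>k. cmod (c k)) UNIV \<le> embed_const * hnorm s c"
    using b by (intro infsum_le_finite_sums) auto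
qed

abbreviation fchar :: "int \<Rightarrow> real \<Rightarrow> complex" where
  "fchar k x \<equiv> cis (2 * pi * real_of_int k * x)"

text \<open>Reindexing by -k conjugates the terms, so the sum equals its own conjugate; the
  \<open>Re\<close> in \<open>fseries\<close> therefore loses nothing.\<close>

lemma fseries_has_sum:
  assumes "real_seq c" "(\<lambda>k. cmod (c k)) summable_on UNIV"
  shows "((\<lambda>k. c k * fchar k x) has_sum complex_of_real (fseries c x)) UNIV"
proof -
  have "(\<lambda>k. c k * fchar k x) summable_on UNIV"
    by (rule abs_summable_summable) (use assms(2) in \<open>simp add: norm_mult\<close>)
  then obtain S where S: "((\<lambda>k. c k * fchar k x) has_sum S) UNIV"
    by (auto simp: summable_on_def)
  have "((\<lambda>k. c (- k) * fchar (- k) x) has_sum S) UNIV"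
    using S has_sum_reindex_bij_betw[of uminus UNIV UNIV "\<lambda>k. c k * fchar k x" S]
    by (simp add: bij_uminus)
  also have "(\<lambda>k. c (- k) * fchar (- k) x) = (\<lambda>k. cnj (c k * fchar k x))"
    using assms(1) by (auto simp: real_seq_def cis_cnj)
  finally have "((\<lambda>k. c k * fchar k x) has_sum cnj S) UNIV"
    using has_sum_cnj_iff[where f="\<lambda>k. c k * fchar k x" and a="cnj S" and M=UNIV] by (simp only: complex_cnj_cnj)
  with S have "S = cnj S" using has_sum_unique by blast
  hence "S \<in> \<real>" by (metis Reals_cnj_iff)
  with S show ?thesis unfolding fseries_def by (simp add: has_sum_iff)
qed

lemma uniform_limit_fseries:
  assumes "real_seq c" "(\<lambda>k. cmod (c k)) summable_on UNIV"
  shows "uniform_limit A (\<lambda>F x. \<Sum>k\<in>F. c k * fchar k x) (\<lambda>x. complex_of_real (fseries c x))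
           (finite_subsets_at_top UNIV)"
  by (rule Weierstrass_m_test_general'[where M="\<lambda>k. cmod (c k)"])
     (use assms fseries_has_sum in \<open>auto simp: norm_mult\<close>)

lemma continuous_on_fseries:
  assumes "real_seq c" "(\<lambda>k. cmod (c k)) summable_on UNIV"
  shows "continuous_on A (fseries c)"
proof -
  have "continuous_on A (\<lambda>x. complex_of_real (fseries c x))"
    by (rule uniform_limit_theorem[OF _ uniform_limit_fseries[OF assms]])
       (auto intro!: always_eventually continuous_intros)
  from continuous_on_Re[OF this] show ?thesis by simp
qed

lemma abs_fseries_le:
  assumes "real_seq c" "hfin s c" "s \<ge> 1"
  shows "\<bar>fseries c x\<bar> \<le> embed_const * hnorm s c"
proof -
  note ab = hfin_abs_summable[OF assms(2,3)]
  have "cmod (complex_of_real (fseries c x)) \<le> infsum (\<lambda>k. cmod (c k)) UNIV"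
    using fseries_has_sum[OF assms(1) ab, of x] ab
    by (intro norm_has_sum_bound[where f="\<lambda>k. c k * fchar k x"]) (auto simp: norm_mult)
  thus ?thesis using infsum_norm_le_hnorm[OF assms(2,3)] by simp
qed

text \<open>Uniform convergence allows integration term by term. With \<open>G\<close> a continuous
  function times a character this becomes the convolution formula; with \<open>G\<close> = sinh u it
  is the Parseval identity behind the gradient.\<close>

lemma integral_fseries_mult:
  fixes G :: "real \<Rightarrow> complex"
  assumes "real_seq c" "(\<lambda>k. cmod (c k)) summable_on UNIV" "continuous_on {0..1} G"
  shows "((\<lambda>k. c k * integral {0..1} (\<lambda>x. fchar k x * G x)) has_sum
           integral {0..1} (\<lambda>x. complex_of_real (fseries c x) * G x)) UNIV"
proof -
  have bdd: "bounded (G ` {0..1})"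
    using assms(3) by (intro compact_imp_bounded compact_continuous_image) auto
  have bdd': "bounded ((\<lambda>x. complex_of_real (fseries c x)) ` {0..1})"
    using continuous_on_fseries[OF assms(1,2)]
    by (intro compact_imp_bounded compact_continuous_image continuous_intros) auto
  have u: "uniform_limit {0..1} (\<lambda>F x. (\<Sum>k\<in>F. c k * fchar k x) * G x)
      (\<lambda>x. complex_of_real (fseries c x) * G x) (finite_subsets_at_top UNIV)"
    by (rule uniform_lim_mult[OF uniform_limit_fseries[OF assms(1,2)] uniform_limit_const bdd' bdd])
  obtain I J where IJ: "\<And>F. ((\<lambda>x. (\<Sum>k\<in>F. c k * fchar k x) * G x) has_integral I F) {0..1}"
    "((\<lambda>x. complex_of_real (fseries c x) * G x) has_integral J) {0..1}"
    "(I \<longlongrightarrow> J) (finite_subsets_at_top UNIV)"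
    by (rule uniform_limit_integral[OF u]) (auto intro!: continuous_intros assms(3))
  have "I F = (\<Sum>k\<in>F. c k * integral {0..1} (\<lambda>x. fchar k x * G x))" if "finite F" for F
  proof -
    have "I F = integral {0..1} (\<lambda>x. \<Sum>k\<in>F. c k * (fchar k x * G x))"
      using IJ(1)[of F] by (simp add: integral_unique sum_distrib_right mult.assoc)
    also have "\<dots> = (\<Sum>k\<in>F. c k * integral {0..1} (\<lambda>x. fchar k x * G x))"
      using that by (subst integral_sum)
        (auto intro!: integrable_continuous_interval continuous_intros assms(3))
    finally show ?thesis .
  qed
  hence "((\<lambda>F. \<Sum>k\<in>F. c k * integral {0..1} (\<lambda>x. fchar k x * G x)) \<longlongrightarrow> J) (finite_subsets_at_top UNIV)"
    using IJ(3) by (subst tendsto_cong[of _ I]) (auto intro: eventually_finite_subsets_at_top_weakI)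
  thus ?thesis using IJ(2) by (simp add: has_sum_def integral_unique)
qed

subsection \<open>The algebra property\<close>

lemma hpart_tendsto:
  assumes "\<And>k. ((\<lambda>n. c n k) \<longlongrightarrow> d k) G"
  shows "((\<lambda>n. hpart s (c n) K) \<longlongrightarrow> hpart s d K) G"
  unfolding hpart_def L2_set_def by (intro tendsto_intros assms)

text \<open>Lower semicontinuity of the norm, as in Fatou's lemma: a bound on each finite set of
  frequencies passes to a coefficientwise limit. The filter is general because this serves both
  unordered partial sums and sequences.\<close>

lemma
  assumes "\<And>k. ((\<lambda>n. c n k) \<longlongrightarrow> d k) G" "G \<noteq> bot"
    and "\<forall>\<^sub>F n in G. \<forall>K. finite K \<longrightarrow> hpart s (c n) K \<le> B"
  shows hfin_limit: "hfin s d" and hnorm_limit_le: "hnorm s d \<le> B"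
proof -
  have "hpart s d K \<le> B" if "finite K" for K
    by (rule tendsto_upperbound[OF hpart_tendsto[OF assms(1)] _ assms(2)])
       (use assms(3) that in \<open>auto elim: eventually_mono\<close>)
  from hfin_boundedI[OF this] hnorm_leI[OF this]
  show "hfin s d" "hnorm s d \<le> B" by blast+
qed

text \<open>As k = j + (k - j), one of the two summands l satisfies 1 + k^2 \<le> 4 (1 + l^2); the
  power s and the square root turn 4 into 2^s.\<close>

lemma sqrt_sob_weight_le:
  "sqrt (sob_weight s k) \<le> 2 ^ s * (sqrt (sob_weight s j) + sqrt (sob_weight s (k - j)))"
proof -
  define x y z where "x = real_of_int k" and "y = real_of_int j" and "z = real_of_int (k - j)"
  have "x = y + z" by (simp add: x_def y_def z_def)
  moreover have "0 \<le> (y - z)\<^sup>2" by simp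
  ultimately have b: "1 + x\<^sup>2 \<le> 2 * (1 + y\<^sup>2) + 2 * (1 + z\<^sup>2)"
    by (simp add: power2_eq_square algebra_simps)
  have *: "sqrt (sob_weight s k) \<le> 2 ^ s * sqrt (sob_weight s l)"
    if "1 + x\<^sup>2 \<le> 4 * (1 + (real_of_int l)\<^sup>2)" for l
  proof -
    have "sob_weight s k \<le> (4 * (1 + (real_of_int l)\<^sup>2)) ^ s"
      unfolding sob_weight_def using that x_def by (intro power_mono) auto
    also have "\<dots> = (2 ^ s)\<^sup>2 * sob_weight s l"
      by (simp add: sob_weight_def power_mult_distrib power2_eq_square flip: power_mult_distrib)
    finally have "sqrt (sob_weight s k) \<le> sqrt ((2 ^ s)\<^sup>2 * sob_weight s l)" by simp
    thus ?thesis by (simp add: real_sqrt_mult)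
  qed
  have nn: "0 \<le> 2 ^ s * sqrt (sob_weight s j)" "0 \<le> 2 ^ s * sqrt (sob_weight s (k - j))" by auto
  have "1 + x\<^sup>2 \<le> 4 * (1 + y\<^sup>2) \<or> 1 + x\<^sup>2 \<le> 4 * (1 + z\<^sup>2)"
    using b by linarith
  with *[of j] *[of "k - j"] nn show ?thesis
    unfolding distrib_left y_def z_def by linarith
qed

lemma L2_set_sum_le:
  assumes "finite F"
  shows "L2_set (\<lambda>k. \<Sum>j\<in>F. a j k) K \<le> (\<Sum>j\<in>F. L2_set (a j) K)"
  using assms
proof (induction F)
  case (insert j F)
  have "L2_set (\<lambda>k. a j k + (\<Sum>j\<in>F. a j k)) K \<le> L2_set (a j) K + L2_set (\<lambda>k. \<Sum>j\<in>F. a j k) K"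
    by (rule L2_set_triangle_ineq)
  with insert show ?case by simp
qed (simp add: L2_set_0')

text \<open>Young's inequality for l^1 and l^2: the convolution is a combination of translates of
  \<open>b\<close>. Translation moves the set \<open>K\<close>, so the bound on \<open>b\<close> has
  to be uniform over finite sets.\<close>

lemma L2_set_convolution_le:
  fixes a b :: "int \<Rightarrow> real"
  assumes "finite F" "finite K" "\<And>j. a j \<ge> 0" "(\<Sum>j\<in>F. a j) \<le> A"
    and "\<And>K. finite K \<Longrightarrow> L2_set b K \<le> B"
  shows "L2_set (\<lambda>k. \<Sum>j\<in>F. a j * b (k - j)) K \<le> A * B"
proof -
  have "B \<ge> 0" using assms(5)[of "{}"] by simp
  have "L2_set (\<lambda>k. \<Sum>j\<in>F. a j * b (k - j)) K \<le> (\<Sum>j\<in>F. L2_set (\<lambda>k. a j * b (k - j)) K)"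
    by (rule L2_set_sum_le[OF assms(1)])
  also have "\<dots> \<le> (\<Sum>j\<in>F. a j * B)"
  proof (rule sum_mono)
    fix j
    have "L2_set (\<lambda>k. a j * b (k - j)) K = a j * L2_set (\<lambda>k. b (k - j)) K"
      by (simp add: L2_set_right_distrib assms(3))
    also have "L2_set (\<lambda>k. b (k - j)) K = L2_set b ((\<lambda>k. k - j) ` K)"
      unfolding L2_set_def by (subst sum.reindex) (auto simp: inj_on_def)
    finally show "L2_set (\<lambda>k. a j * b (k - j)) K \<le> a j * B"
      using assms(2,3,5) by (simp add: mult_left_mono)
  qed
  also have "\<dots> \<le> A * B"
    using assms(4) \<open>B \<ge> 0\<close> by (simp add: sum_distrib_right[symmetric] mult_right_mono)
  finally show ?thesis .
qed

text \<open>A factor 2^s comes from splitting the weight, a factor 2 from the two resulting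
  convolutions, and the embedding constant from the factor measured in l^1.\<close>

definition alg_const :: "nat \<Rightarrow> real" where
  "alg_const s = 2 ^ s * 2 * embed_const"

lemma alg_const_nonneg: "alg_const s \<ge> 0"
  by (simp add: alg_const_def embed_const_nonneg)

text \<open>After the weight is split, it falls on one factor, measured in l^2, while the other is
  measured in l^1 through the embedding. Young's inequality then treats both terms.\<close>

lemma hpart_convolution_le:
  assumes u: "hfin s u" and b: "hfin s b" and s: "s \<ge> 1" and fin: "finite F" "finite K"
  shows "hpart s (\<lambda>k. \<Sum>j\<in>F. u j * b (k - j)) K \<le> alg_const s * hnorm s u * hnorm s b"
proof -
  define w where "w k = sqrt (sob_weight s k)" for k
  define U V where "U j = w j * cmod (u j)" and "V j = w j * cmod (b j)" for j
  have w0: "w k \<ge> 0" for k by (simp add: w_def)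
  \<comment> \<open>The substitution i = k - j brings the term with the weight on \<open>u\<close>
    into the form of Young's inequality, but its index set then depends on k. \<open>F'\<close> is a
    common superset for all k in \<open>K\<close>; enlarging is harmless since the terms are
    nonnegative.\<close>
  define F' where "F' = (\<Union>k\<in>K. (\<lambda>j. k - j) ` F)"
  have finF': "finite F'" using fin by (auto simp: F'_def)
  have l1: "(\<Sum>j\<in>G. cmod (c j)) \<le> embed_const * hnorm s c" if "hfin s c" "finite G" for c G
    using finite_sum_le_infsum[OF hfin_abs_summable[OF that(1) s] that(2)]
      infsum_norm_le_hnorm[OF that(1) s] by simp
  have l2: "L2_set U G \<le> hnorm s u" "L2_set V G \<le> hnorm s b" if "finite G" for G
    using hpart_le_hnorm[OF u that] hpart_le_hnorm[OF b that]
    unfolding hpart_def U_def V_def w_def by auto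
  have "hpart s (\<lambda>k. \<Sum>j\<in>F. u j * b (k - j)) K
      \<le> L2_set (\<lambda>k. 2 ^ s * ((\<Sum>i\<in>F'. cmod (b i) * U (k - i)) + (\<Sum>j\<in>F. cmod (u j) * V (k - j)))) K"
    unfolding hpart_def w_def[symmetric]
  proof (rule L2_set_mono)
    fix k assume k: "k \<in> K"
    have "w k * cmod (\<Sum>j\<in>F. u j * b (k - j)) \<le> w k * (\<Sum>j\<in>F. cmod (u j) * cmod (b (k - j)))"
      by (intro mult_left_mono w0 sum_norm_le) (auto simp: norm_mult)
    also have "\<dots> = (\<Sum>j\<in>F. w k * (cmod (u j) * cmod (b (k - j))))"
      by (simp add: sum_distrib_left)
    also have "\<dots> \<le> (\<Sum>j\<in>F. 2 ^ s * (w j + w (k - j)) * (cmod (u j) * cmod (b (k - j))))"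
      unfolding w_def by (intro sum_mono mult_right_mono sqrt_sob_weight_le) auto
    also have "\<dots> = 2 ^ s * ((\<Sum>j\<in>F. cmod (b (k - j)) * U j) + (\<Sum>j\<in>F. cmod (u j) * V (k - j)))"
      by (simp add: U_def V_def sum_distrib_left sum.distrib[symmetric] algebra_simps)
    also have "(\<Sum>j\<in>F. cmod (b (k - j)) * U j) = (\<Sum>i\<in>(\<lambda>j. k - j) ` F. cmod (b i) * U (k - i))"
      by (subst sum.reindex) (auto simp: inj_on_def)
    also have "\<dots> \<le> (\<Sum>i\<in>F'. cmod (b i) * U (k - i))"
      using k finF' w0 by (intro sum_mono2) (auto simp: F'_def U_def)
    finally show "w k * cmod (\<Sum>j\<in>F. u j * b (k - j))
        \<le> 2 ^ s * ((\<Sum>i\<in>F'. cmod (b i) * U (k - i)) + (\<Sum>j\<in>F. cmod (u j) * V (k - j)))"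
      by simp
  qed (auto simp: w0)
  also have "\<dots> = 2 ^ s * L2_set (\<lambda>k. (\<Sum>i\<in>F'. cmod (b i) * U (k - i)) + (\<Sum>j\<in>F. cmod (u j) * V (k - j))) K"
    by (simp add: L2_set_right_distrib)
  also have "\<dots> \<le> 2 ^ s * (L2_set (\<lambda>k. \<Sum>i\<in>F'. cmod (b i) * U (k - i)) K
      + L2_set (\<lambda>k. \<Sum>j\<in>F. cmod (u j) * V (k - j)) K)"
    by (intro mult_left_mono L2_set_triangle_ineq) auto
  also have "\<dots> \<le> 2 ^ s * ((embed_const * hnorm s b) * hnorm s u + (embed_const * hnorm s u) * hnorm s b)"
    by (intro mult_left_mono add_mono L2_set_convolution_le finF' fin l1 l2 u b) auto
  also have "\<dots> = alg_const s * hnorm s u * hnorm s b"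
    by (simp add: alg_const_def algebra_simps)
  finally show ?thesis .
qed

lemma
  assumes "hfin s u" "hfin s b" "s \<ge> 1"
    and "\<And>k. ((\<lambda>j. u j * b (k - j)) has_sum c k) UNIV"
  shows hfin_convolution: "hfin s c"
    and hnorm_convolution: "hnorm s c \<le> alg_const s * hnorm s u * hnorm s b"
proof -
  have *: "\<forall>\<^sub>F F in finite_subsets_at_top UNIV. \<forall>K. finite K \<longrightarrow>
      hpart s (\<lambda>k. \<Sum>j\<in>F. u j * b (k - j)) K \<le> alg_const s * hnorm s u * hnorm s b"
    using hpart_convolution_le[OF assms(1-3)] by (auto intro: eventually_finite_subsets_at_top_weakI)
  have t: "((\<lambda>F. \<Sum>j\<in>F. u j * b (k - j)) \<longlongrightarrow> c k) (finite_subsets_at_top UNIV)" for k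
    using assms(4)[of k] by (simp add: has_sum_def)
  show "hfin s c" "hnorm s c \<le> alg_const s * hnorm s u * hnorm s b"
    using hfin_limit[OF t _ *] hnorm_limit_le[OF t _ *] by auto
qed

section \<open>Fourier coefficients of products, powers and exponentials\<close>

lemma fcoef_integrable:
  assumes "continuous_on {0..1} f"
  shows "(\<lambda>x. complex_of_real (f x) * cis (- (2 * pi * real_of_int k * x))) integrable_on {0..1}"
  by (intro integrable_continuous_interval continuous_intros assms)

lemma fcoef_scale: "fcoef (\<lambda>x. a * f x) k = complex_of_real a * fcoef f k"
  unfolding fcoef_def by (simp add: mult.assoc)

lemma fcoef_add:
  assumes "continuous_on {0..1} f" "continuous_on {0..1} g"
  shows "fcoef (\<lambda>x. f x + g x) k = fcoef f k + fcoef g k"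
  unfolding fcoef_def using integral_add[OF fcoef_integrable[OF assms(1)] fcoef_integrable[OF assms(2)]]
  by (simp add: distrib_right)

lemma fcoef_sum:
  assumes "\<And>n. continuous_on {0..1} (f n)"
  shows "fcoef (\<lambda>x. \<Sum>n<N. f n x) k = (\<Sum>n<(N::nat). fcoef (f n) k)"
proof (induction N)
  case (Suc N)
  have "continuous_on {0..1} (\<lambda>x. \<Sum>n<N. f n x)" by (intro continuous_intros assms)
  with Suc show ?case by (simp add: fcoef_add assms)
qed (simp add: fcoef_def)

lemma real_seq_fcoef: "real_seq (fcoef f)"
proof -
  have "cnj (fcoef f k) = fcoef f (- k)" for k
    unfolding fcoef_def by (simp add: integral_cnj cis_cnj)
  thus ?thesis by (simp add: real_seq_def)
qed

lemma fcoef_zero: "continuous_on {0..1} f \<Longrightarrow> fcoef f 0 = complex_of_real (intT f)"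
  unfolding fcoef_def intT_def
  using has_integral_of_real[OF integrable_integral[OF integrable_continuous_interval], of 0 1 f, where 'b=complex]
  by (simp add: integral_unique)

lemma fcoef_const: "fcoef (\<lambda>x. 1) k = (if k = 0 then 1 else 0)"
proof (cases "k = 0")
  case False
  define z where "z = - (2 * pi * real_of_int k) *\<^sub>R \<i>"
  have z: "z \<noteq> 0" using False by (simp add: z_def)
  have c: "cis (- (2 * pi * real_of_int k * x)) = exp (x *\<^sub>R z)" for x
    by (simp add: cis_conv_exp z_def scaleR_conv_of_real algebra_simps)
  have "((\<lambda>x. exp (x *\<^sub>R z)) has_integral (exp (1 *\<^sub>R z) / z - exp (0 *\<^sub>R z) / z)) {0..1}"
  proof (rule fundamental_theorem_of_calculus)
    fix x :: real
    show "((\<lambda>x. exp (x *\<^sub>R z) / z) has_vector_derivative exp (x *\<^sub>R z)) (at x within {0..1})"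
      using has_vector_derivative_divide[OF exp_scaleR_has_vector_derivative_right[of z x "{0..1}"], of z] z
      by simp
  qed simp
  moreover have "exp z = 1"
    using c[of 1] cis_multiple_2pi[of "- of_int k"] by simp
  ultimately show ?thesis using False by (simp add: fcoef_def c integral_unique)
qed (simp add: fcoef_def)

text \<open>Only \<open>u\<close> is expanded into its series; \<open>g\<close> enters through its
  integrals \<open>fcoef g\<close> alone. This asymmetry lets powers be handled by induction without
  knowing that a continuous function is the sum of its Fourier series.\<close>

lemma fcoef_fseries_mult:
  assumes "real_seq u" "(\<lambda>k. cmod (u k)) summable_on UNIV" "continuous_on {0..1} g"
  shows "((\<lambda>j. u j * fcoef g (k - j)) has_sum fcoef (\<lambda>x. fseries u x * g x) k) UNIV"
proof -
  define G where "G x = complex_of_real (g x) * cis (- (2 * pi * real_of_int k * x))" for x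
  have "continuous_on {0..1} G"
    unfolding G_def by (intro continuous_intros assms)
  note * = integral_fseries_mult[OF assms(1,2) this]
  have "(\<lambda>x. fchar j x * G x) = (\<lambda>x. complex_of_real (g x) * cis (- (2 * pi * real_of_int (k - j) * x)))" for j
    unfolding G_def by (auto simp: cis_mult algebra_simps fun_eq_iff)
  hence "integral {0..1} (\<lambda>x. fchar j x * G x) = fcoef g (k - j)" for j
    by (simp add: fcoef_def)
  moreover have "integral {0..1} (\<lambda>x. complex_of_real (fseries u x) * G x) = fcoef (\<lambda>x. fseries u x * g x) k"
    by (simp add: fcoef_def G_def mult.assoc)
  ultimately show ?thesis using * by simp
qed

text \<open>Each further factor is a convolution with \<open>u\<close> and costs
  \<open>alg_const s * hnorm s u\<close>. The induction starts from the constant function 1, whose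
  only coefficient is the zero mode, of norm 1.\<close>

lemma
  assumes u: "real_seq u" "hfin s u" "s \<ge> 1"
  shows hfin_fcoef_power: "hfin s (fcoef (\<lambda>x. fseries u x ^ n))"
    and hnorm_fcoef_power: "hnorm s (fcoef (\<lambda>x. fseries u x ^ n)) \<le> (alg_const s * hnorm s u) ^ n"
proof (induction n)
  case 0
  have eq: "fcoef (\<lambda>x. 1) = (\<lambda>k. if k = 0 then 1 else 0)" by (auto simp: fcoef_const)
  { case 1 show ?case by (simp add: eq hfin_single) }
  { case 2 show ?case by (simp add: eq hnorm_single) }
next
  case (Suc n)
  note ab = hfin_abs_summable[OF u(2,3)]
  have c: "continuous_on {0..1} (\<lambda>x. fseries u x ^ n)"
    by (intro continuous_intros continuous_on_fseries u ab)
  note m = fcoef_fseries_mult[OF u(1) ab c]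
  { case 1 show ?case using hfin_convolution[OF u(2) Suc(1) u(3) m] by simp }
  { case 2
    have "hnorm s (fcoef (\<lambda>x. fseries u x ^ Suc n))
        \<le> alg_const s * hnorm s u * hnorm s (fcoef (\<lambda>x. fseries u x ^ n))"
      using hnorm_convolution[OF u(2) Suc(1) u(3) m] by simp
    also have "\<dots> \<le> alg_const s * hnorm s u * (alg_const s * hnorm s u) ^ n"
      by (intro mult_left_mono Suc(2)) (simp add: alg_const_nonneg)
    finally show ?case by simp }
qed

lemma hpart_sum_le:
  assumes "\<And>n. hfin s (c n)" "finite K"
  shows "hpart s (\<lambda>k. \<Sum>n<(N::nat). c n k) K \<le> (\<Sum>n<N. hnorm s (c n))"
proof (induction N)
  case (Suc N)
  have "hpart s (\<lambda>k. (\<Sum>n<N. c n k) + c N k) K \<le> hpart s (\<lambda>k. \<Sum>n<N. c n k) K + hpart s (c N) K"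
    by (rule hpart_add)
  with Suc hpart_le_hnorm[OF assms(1)[of N] assms(2)] show ?case by simp
qed (simp add: hpart_def L2_set_0')

lemma fcoef_tendsto:
  assumes "uniform_limit {0..1} f g sequentially" "\<And>n. continuous_on {0..1} (f n)"
  shows "(\<lambda>n. fcoef (f n) k) \<longlonglongrightarrow> fcoef g k"
proof -
  have g: "continuous_on {0..1} g"
    by (rule uniform_limit_theorem[OF _ assms(1)]) (auto simp: assms)
  have bd: "bounded ((\<lambda>x. complex_of_real (g x)) ` {0..1})"
    "bounded ((\<lambda>x. cis (- (2 * pi * real_of_int k * x))) ` {0..1})"
    by (intro compact_imp_bounded compact_continuous_image continuous_intros g compact_Icc)+
  have "uniform_limit {0..1} (\<lambda>n x. complex_of_real (f n x)) (\<lambda>x. complex_of_real (g x)) sequentially"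
    by (rule bounded_linear.uniform_limit[OF bounded_linear_of_real assms(1)])
  note u = uniform_lim_mult[OF this uniform_limit_const bd]
  obtain I J where IJ: "\<And>n. ((\<lambda>x. complex_of_real (f n x) * cis (- (2 * pi * real_of_int k * x))) has_integral I n) {0..1}"
    "((\<lambda>x. complex_of_real (g x) * cis (- (2 * pi * real_of_int k * x))) has_integral J) {0..1}"
    "I \<longlonglongrightarrow> J"
    by (rule uniform_limit_integral[OF u]) (auto intro!: continuous_intros assms)
  have "I = (\<lambda>n. fcoef (f n) k)" "J = fcoef g k"
    unfolding fcoef_def using integral_unique[OF IJ(1)] integral_unique[OF IJ(2)] by auto
  with IJ(3) show ?thesis by simp
qed

lemma uniform_limit_exp_partial_sums:
  fixes f :: "'a \<Rightarrow> real"
  assumes "\<And>x. x \<in> A \<Longrightarrow> \<bar>f x\<bar> \<le> B"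
  shows "uniform_limit A (\<lambda>N x. \<Sum>n<N. f x ^ n / fact n) (\<lambda>x. exp (f x)) sequentially"
proof -
  have "uniform_limit A (\<lambda>N x. \<Sum>n<N. f x ^ n / fact n) (\<lambda>x. suminf (\<lambda>n. f x ^ n / fact n)) sequentially"
  proof (rule Weierstrass_m_test)
    fix n x assume "x \<in> A"
    thus "norm (f x ^ n / fact n) \<le> B ^ n / fact n"
      by (simp add: power_abs divide_right_mono power_mono assms)
  next
    show "summable (\<lambda>n. B ^ n / fact n)"
      using summable_exp[of B] by (simp add: divide_inverse mult.commute)
  qed
  thus ?thesis by (simp add: exp_def divide_inverse mult.commute)
qed

lemma hfin_fcoef_exp:
  assumes u: "real_seq u" "hfin s u" "s \<ge> 1"
  shows "hfin s (fcoef (\<lambda>x. exp (fseries u x)))"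
proof -
  define r where "r = alg_const s * hnorm s u"
  have r: "r \<ge> 0" by (simp add: r_def alg_const_nonneg)
  have cont: "continuous_on {0..1} (\<lambda>x. fseries u x ^ n / fact n)" for n
    by (intro continuous_intros continuous_on_fseries u hfin_abs_summable[OF u(2,3)]) auto
  define c where "c n = fcoef (\<lambda>x. fseries u x ^ n / fact n)" for n
  have c: "c n = (\<lambda>k. complex_of_real (1 / fact n) * fcoef (\<lambda>x. fseries u x ^ n) k)" for n
    unfolding c_def fcoef_scale[symmetric] by simp
  have cfin: "hfin s (c n)" for n
    unfolding c by (intro hfin_scale hfin_fcoef_power u)
  have cn: "hnorm s (c n) \<le> r ^ n / fact n" for n
    unfolding c hnorm_scale r_def using hnorm_fcoef_power[OF u, of n]
    by (simp add: norm_divide divide_right_mono)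
  have "(\<Sum>n<N. hnorm s (c n)) \<le> exp r" for N
  proof -
    have "(\<Sum>n<N. hnorm s (c n)) \<le> (\<Sum>n<N. r ^ n / fact n)" by (intro sum_mono cn)
    also have "\<dots> \<le> (\<Sum>n. r ^ n / fact n)"
      using r summable_exp[of r] by (intro sum_le_suminf) (auto simp: divide_inverse mult.commute)
    finally show ?thesis by (simp add: exp_def divide_inverse mult.commute)
  qed
  hence b: "\<forall>\<^sub>F N in sequentially. \<forall>K. finite K \<longrightarrow> hpart s (\<lambda>k. \<Sum>n<N. c n k) K \<le> exp r"
    by (intro always_eventually allI impI order_trans[OF hpart_sum_le[OF cfin]])
  have "(\<lambda>N. fcoef (\<lambda>x. \<Sum>n<N. fseries u x ^ n / fact n) k) \<longlonglongrightarrow> fcoef (\<lambda>x. exp (fseries u x)) k" for k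
    by (rule fcoef_tendsto[OF uniform_limit_exp_partial_sums[OF abs_fseries_le[OF u]]])
       (intro continuous_intros cont)
  hence "(\<lambda>N. \<Sum>n<N. c n k) \<longlonglongrightarrow> fcoef (\<lambda>x. exp (fseries u x)) k" for k
    by (simp add: fcoef_sum cont c_def)
  from hfin_limit[OF this _ b] show ?thesis by simp
qed

subsection \<open>Linear operations on the Sobolev spaces\<close>

lemma Hs_abs_summable: "c \<in> Hs s \<Longrightarrow> s \<ge> 1 \<Longrightarrow> (\<lambda>k. cmod (c k)) summable_on UNIV"
  by (auto simp: Hs_iff intro: hfin_abs_summable)

lemma continuous_on_fseries_Hs: "c \<in> Hs s \<Longrightarrow> s \<ge> 1 \<Longrightarrow> continuous_on A (fseries c)"
  using Hs_abs_summable by (auto simp: Hs_iff intro: continuous_on_fseries)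

lemma Hs_lincomb:
  assumes "c \<in> Hs s" "d \<in> Hs s"
  shows "(\<lambda>k. complex_of_real a * c k + complex_of_real b * d k) \<in> Hs s"
  using assms by (auto simp: Hs_iff real_seq_def intro!: hfin_add hfin_scale)

lemma sadd_Hs: "c \<in> Hs s \<Longrightarrow> d \<in> Hs s \<Longrightarrow> sadd c d \<in> Hs s"
  using Hs_lincomb[of c s d 1 1] by (simp add: sadd_def)

lemma Hs_const: "(\<lambda>k. if k = 0 then complex_of_real a else 0) \<in> Hs s"
  by (auto simp: Hs_iff real_seq_def hfin_single)

lemma fseries_lincomb:
  assumes "c \<in> Hs s" "d \<in> Hs s" "s \<ge> 1"
  shows "fseries (\<lambda>k. complex_of_real a * c k + complex_of_real b * d k) x = a * fseries c x + b * fseries d x"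
proof -
  have h: "((\<lambda>k. c k * fchar k x) has_sum complex_of_real (fseries c x)) UNIV" if "c \<in> Hs s" for c
    using that Hs_abs_summable[OF that assms(3)] by (intro fseries_has_sum) (auto simp: Hs_iff)
  have "((\<lambda>k. complex_of_real a * (c k * fchar k x) + complex_of_real b * (d k * fchar k x)) has_sum
      (complex_of_real a * complex_of_real (fseries c x) + complex_of_real b * complex_of_real (fseries d x))) UNIV"
    by (intro has_sum_add has_sum_cmult_right h assms)
  hence "((\<lambda>k. (complex_of_real a * c k + complex_of_real b * d k) * fchar k x) has_sum
      (complex_of_real (a * fseries c x + b * fseries d x))) UNIV"
    by (simp add: algebra_simps)
  from has_sum_unique[OF this h[OF Hs_lincomb[OF assms(1,2)]]] show ?thesis
    by (metis of_real_eq_iff)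
qed

lemma fseries_const: "fseries (\<lambda>k. if k = 0 then complex_of_real a else 0) x = a"
proof -
  have "((\<lambda>k. (if k = 0 then complex_of_real a else 0) * fchar k x) has_sum complex_of_real a) UNIV"
    by (rule has_sum_finite_neutralI[of "{0}"]) auto
  thus ?thesis unfolding fseries_def by (simp add: has_sum_iff)
qed

text \<open>For k \<noteq> 0 one has 1 + k^2 \<le> 2 k^2 \<le> (2 pi k)^2, so the gain of one order
  costs only the constant 1. The zero mode is discarded, which makes the bound valid on all of
  \<open>Hs m\<close>.\<close>

lemma
  assumes "v \<in> Hs m"
  shows antider_Hs: "antider v \<in> Hs (m + 1)"
    and hnorm_antider: "hnorm (m + 1) (antider v) \<le> hnorm m v"
proof -
  have *: "sqrt (sob_weight (m + 1) k) * cmod (antider v k) \<le> 1 * (sqrt (sob_weight m k) * cmod (v k))" for k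
  proof (cases "k = 0")
    case False
    have k1: "1 \<le> (real_of_int k)\<^sup>2" using False by (simp add: one_le_power flip: abs_le_square_iff[of 1, simplified])
    have "1 * 1 \<le> pi * pi" using pi_ge_two by (intro mult_mono) auto
    hence "1 + (real_of_int k)\<^sup>2 \<le> (2 * pi * real_of_int k)\<^sup>2"
      using k1 mult_right_mono[of 1 "pi * pi" "(real_of_int k)\<^sup>2"]
      by (simp add: power2_eq_square algebra_simps)
    hence s: "sqrt (1 + (real_of_int k)\<^sup>2) \<le> 2 * pi * \<bar>real_of_int k\<bar>"
      by (intro real_le_lsqrt) (auto simp: power_mult_distrib)
    have "sqrt (sob_weight (m + 1) k) * cmod (antider v k)
        = sqrt (sob_weight m k) * cmod (v k) * (sqrt (1 + (real_of_int k)\<^sup>2) / (2 * pi * \<bar>real_of_int k\<bar>))"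
      using False by (simp add: sob_weight_def antider_def real_sqrt_mult norm_divide norm_mult)
    also have "\<dots> \<le> sqrt (sob_weight m k) * cmod (v k) * 1"
      using s False by (intro mult_left_mono) (auto simp: divide_le_eq_1)
    finally show ?thesis by simp
  qed (simp add: antider_def)
  have v: "hfin m v" "real_seq v" using assms by (auto simp: Hs_iff)
  have "real_seq (antider v)" using v(2) by (auto simp: real_seq_def antider_def)
  thus "antider v \<in> Hs (m + 1)" using hfin_dominated[OF v(1) _ *] by (simp add: Hs_iff)
  show "hnorm (m + 1) (antider v) \<le> hnorm m v" using hnorm_dominated[OF v(1) _ *] by simp
qed

lemma
  assumes "hfin (m + 1) u"
  shows hfin_dx: "hfin m (dx u)"
    and hnorm_dx: "hnorm m (dx u) \<le> 2 * pi * hnorm (m + 1) u"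
proof -
  have *: "sqrt (sob_weight m k) * cmod (dx u k) \<le> 2 * pi * (sqrt (sob_weight (m + 1) k) * cmod (u k))" for k
  proof -
    have "\<bar>real_of_int k\<bar> \<le> sqrt (1 + (real_of_int k)\<^sup>2)"
      by (rule real_le_rsqrt) simp
    hence "2 * pi * (sqrt (sob_weight m k) * cmod (u k)) * \<bar>real_of_int k\<bar>
        \<le> 2 * pi * (sqrt (sob_weight m k) * cmod (u k)) * sqrt (1 + (real_of_int k)\<^sup>2)"
      by (intro mult_left_mono) auto
    thus ?thesis by (simp add: sob_weight_def dx_def real_sqrt_mult norm_mult mult_ac)
  qed
  show "hfin m (dx u)" "hnorm m (dx u) \<le> 2 * pi * hnorm (m + 1) u"
    using hfin_dominated[OF assms _ *] hnorm_dominated[OF assms _ *] by simp_all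
qed

lemma dx_Hs0: "u \<in> Hs (m + 1) \<Longrightarrow> dx u \<in> Hs0 m"
  by (auto simp: Hs_iff Hs0_iff hfin_dx real_seq_def dx_def)

lemma dx_antider: "v 0 = 0 \<Longrightarrow> dx (antider v) = v"
  by (auto simp: dx_def antider_def)

lemma antider_lincomb: "antider (\<lambda>k. a * c k + b * d k) = (\<lambda>k. a * antider c k + b * antider d k)"
  by (auto simp: antider_def add_divide_distrib)

lemma Hs0_Hs: "v \<in> Hs0 m \<Longrightarrow> v \<in> Hs m"
  by (simp add: Hs0_def)

subsection \<open>The normalizing constant\<close>

lemma intT_exp_pos:
  assumes "continuous_on {0..1} f"
  shows "intT (\<lambda>x. exp (f x)) > 0"
proof -
  have "integral {0..1} (\<lambda>x. exp (f x)) \<noteq> 0"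
    by (subst integral_eq_0_iff) (auto intro!: continuous_intros assms)
  moreover have "integral {0..1} (\<lambda>x. exp (f x)) \<ge> 0"
    by (intro integral_nonneg integrable_continuous_interval continuous_intros assms) auto
  ultimately show ?thesis by (simp add: intT_def)
qed

lemma intT_cosh:
  assumes "continuous_on {0..1} f"
  shows "intT (\<lambda>x. cosh (f x + c))
           = (exp c * intT (\<lambda>x. exp (f x)) + exp (- c) * intT (\<lambda>x. exp (- f x))) / 2"
    and intT_sinh: "intT (\<lambda>x. sinh (f x + c))
           = (exp c * intT (\<lambda>x. exp (f x)) - exp (- c) * intT (\<lambda>x. exp (- f x))) / 2"
proof -
  have i: "((\<lambda>x. exp (f x)) has_integral intT (\<lambda>x. exp (f x))) {0..1}"
    "((\<lambda>x. exp (- f x)) has_integral intT (\<lambda>x. exp (- f x))) {0..1}"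
    unfolding intT_def
    by (intro integrable_integral integrable_continuous_interval continuous_intros assms)+
  have "((\<lambda>x. (exp c * exp (f x) + exp (- c) * exp (- f x)) / 2) has_integral
      (exp c * intT (\<lambda>x. exp (f x)) + exp (- c) * intT (\<lambda>x. exp (- f x))) / 2) {0..1}"
    by (intro has_integral_divide has_integral_add has_integral_mult_right i)
  moreover have "(exp c * exp (f x) + exp (- c) * exp (- f x)) / 2 = cosh (f x + c)" for x
    by (simp add: cosh_field_def exp_add[symmetric] add.commute)
  ultimately show "intT (\<lambda>x. cosh (f x + c))
           = (exp c * intT (\<lambda>x. exp (f x)) + exp (- c) * intT (\<lambda>x. exp (- f x))) / 2"
    unfolding intT_def[of "\<lambda>x. cosh (f x + c)"] by (simp add: integral_unique)
  have "((\<lambda>x. (exp c * exp (f x) - exp (- c) * exp (- f x)) / 2) has_integral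
      (exp c * intT (\<lambda>x. exp (f x)) - exp (- c) * intT (\<lambda>x. exp (- f x))) / 2) {0..1}"
    by (intro has_integral_divide has_integral_diff has_integral_mult_right i)
  moreover have "(exp c * exp (f x) - exp (- c) * exp (- f x)) / 2 = sinh (f x + c)" for x
    by (simp add: sinh_field_def exp_add[symmetric] add.commute)
  ultimately show "intT (\<lambda>x. sinh (f x + c))
           = (exp c * intT (\<lambda>x. exp (f x)) - exp (- c) * intT (\<lambda>x. exp (- f x))) / 2"
    unfolding intT_def[of "\<lambda>x. sinh (f x + c)"] by (simp add: integral_unique)
qed

lemma intT_sinh_eq_0_iff:
  assumes "continuous_on {0..1} f"
  shows "intT (\<lambda>x. sinh (f x + c)) = 0
           \<longleftrightarrow> c = (ln (intT (\<lambda>x. exp (- f x))) - ln (intT (\<lambda>x. exp (f x)))) / 2"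
proof -
  define P Q where "P = intT (\<lambda>x. exp (f x))" and "Q = intT (\<lambda>x. exp (- f x))"
  have pos: "P > 0" "Q > 0"
    unfolding P_def Q_def by (intro intT_exp_pos continuous_intros assms)+
  have "intT (\<lambda>x. sinh (f x + c)) = 0 \<longleftrightarrow> exp c * P = exp (- c) * Q"
    by (simp add: intT_sinh[OF assms] P_def Q_def)
  also have "\<dots> \<longleftrightarrow> ln (exp c * P) = ln (exp (- c) * Q)"
    using pos by simp
  also have "\<dots> \<longleftrightarrow> c = (ln Q - ln P) / 2"
    using pos by (simp add: ln_mult) argo
  finally show ?thesis by (simp add: P_def Q_def)
qed

text \<open>The values a = 2 and a = -2 give the P and Q of the overview. Keeping a as a parameter
  lets every estimate be made once for both.\<close>

definition expint :: "real \<Rightarrow> fseq \<Rightarrow> real" where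
  "expint a v = intT (\<lambda>x. exp (a * fseries (antider v) x))"

lemma continuous_on_fseries_antider: "v \<in> Hs m \<Longrightarrow> continuous_on A (fseries (antider v))"
  using continuous_on_fseries_Hs[OF antider_Hs] by simp

lemma expint_pos: "v \<in> Hs m \<Longrightarrow> expint a v > 0"
  unfolding expint_def by (intro intT_exp_pos continuous_intros continuous_on_fseries_antider)

lemma
  assumes "v \<in> Hs m"
  shows intT_sinh_antider: "intT (\<lambda>x. sinh (2 * fseries (antider v) x)) = (expint 2 v - expint (-2) v) / 2"
    and intT_cosh_antider: "intT (\<lambda>x. cosh (2 * fseries (antider v) x)) = (expint 2 v + expint (-2) v) / 2"
proof -
  have c: "continuous_on {0..1} (\<lambda>x. 2 * fseries (antider v) x)"
    by (intro continuous_intros continuous_on_fseries_antider[OF assms])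
  show "intT (\<lambda>x. sinh (2 * fseries (antider v) x)) = (expint 2 v - expint (-2) v) / 2"
    "intT (\<lambda>x. cosh (2 * fseries (antider v) x)) = (expint 2 v + expint (-2) v) / 2"
    using intT_sinh[OF c, of 0] intT_cosh[OF c, of 0] by (simp_all add: expint_def)
qed

text \<open>The quotient of the two means is t = (P - Q) / (P + Q), for which (1 + t) / (1 - t) = P
  / Q; so artanh t is half of ln (P / Q).\<close>

lemma c_sh_eq:
  assumes "v \<in> Hs m"
  shows "c_sh v = (ln (expint (-2) v) - ln (expint 2 v)) / 2"
proof -
  define P Q where "P = expint 2 v" and "Q = expint (-2) v"
  have pos: "P > 0" "Q > 0" using expint_pos[OF assms] by (auto simp: P_def Q_def)
  have "(1 + (P - Q) / (P + Q)) / (1 - (P - Q) / (P + Q)) = P / Q"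
    using pos by (simp add: divide_simps add_pos_pos)
  hence "artanh ((P - Q) / (P + Q)) = ln (P / Q) / 2" by (simp add: artanh_def)
  moreover have "(x / 2) / (y / 2) = x / y" for x y :: real by simp
  ultimately have "c_sh v = - (ln (P / Q) / 2)"
    unfolding c_sh_def intT_sinh_antider[OF assms] intT_cosh_antider[OF assms] P_def[symmetric] Q_def[symmetric]
    by presburger
  thus ?thesis using pos by (simp add: ln_div P_def[symmetric] Q_def[symmetric] field_simps)
qed

lemma Psi_sh_Hs: "v \<in> Hs m \<Longrightarrow> Psi_sh v \<in> Hs (m + 1)"
  using Hs_lincomb[OF antider_Hs Hs_const, of v m 2 1] by (simp add: Psi_sh_def)

lemma fseries_Psi_sh:
  assumes "v \<in> Hs m"
  shows "fseries (Psi_sh v) x = 2 * fseries (antider v) x + c_sh v"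
  using fseries_lincomb[OF antider_Hs[OF assms] Hs_const, of 2 1 "c_sh v" x]
  by (simp add: Psi_sh_def fseries_const)

lemma intT_sinh_Psi_sh:
  assumes "v \<in> Hs m"
  shows "intT (\<lambda>x. sinh (fseries (Psi_sh v) x)) = 0"
proof -
  have c: "continuous_on {0..1} (\<lambda>x. 2 * fseries (antider v) x)"
    by (intro continuous_intros continuous_on_fseries_antider[OF assms])
  show ?thesis
    unfolding fseries_Psi_sh[OF assms] intT_sinh_eq_0_iff[OF c]
    by (simp add: c_sh_eq[OF assms] expint_def)
qed

text \<open>At the normalizing constant, e^c P and e^(-c) Q both equal the square root of P Q, and
  so does the mean of cosh u. Writing the root as an exponential of logarithms prepares the chain
  rule.\<close>

lemma H_sh_eq:
  assumes "v \<in> Hs m"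
  shows "H_sh v = - 1 / 4 * exp ((ln (expint 2 v) + ln (expint (-2) v)) / 2)"
proof -
  define P Q where "P = expint 2 v" and "Q = expint (-2) v"
  have pos: "P > 0" "Q > 0" using expint_pos[OF assms] by (auto simp: P_def Q_def)
  have c: "continuous_on {0..1} (\<lambda>x. 2 * fseries (antider v) x)"
    by (intro continuous_intros continuous_on_fseries_antider[OF assms])
  have 1: "exp ((ln Q - ln P) / 2) * P = exp ((ln P + ln Q) / 2)"
  proof -
    have "exp ((ln Q - ln P) / 2) * exp (ln P) = exp ((ln P + ln Q) / 2)"
      unfolding exp_add[symmetric] by (simp add: field_simps)
    thus ?thesis using pos by simp
  qed
  have 2: "exp (- ((ln Q - ln P) / 2)) * Q = exp ((ln P + ln Q) / 2)"
  proof -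
    have "exp (- ((ln Q - ln P) / 2)) * exp (ln Q) = exp ((ln P + ln Q) / 2)"
      unfolding exp_add[symmetric] by (simp add: field_simps)
    thus ?thesis using pos by simp
  qed
  have "intT (\<lambda>x. cosh (fseries (Psi_sh v) x)) = (exp (c_sh v) * P + exp (- c_sh v) * Q) / 2"
    using intT_cosh[OF c, of "c_sh v"] by (simp add: fseries_Psi_sh[OF assms] expint_def P_def Q_def)
  also have "\<dots> = exp ((ln P + ln Q) / 2)"
    using 1 2 by (simp add: c_sh_eq[OF assms] P_def[symmetric] Q_def[symmetric])
  finally show ?thesis by (simp add: H_sh_def P_def Q_def)
qed

section \<open>The vector field and the inverse of the transformation\<close>

lemma sinh_seq_Psi_sh:
  assumes "v \<in> Hs m"
  shows "sinh_seq (Psi_sh v) k = 2 * X_sh v k"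
  using fcoef_scale[of "1/2" "\<lambda>x. sinh (fseries (Psi_sh v) x)" k]
  by (simp add: sinh_seq_def X_sh_def mult.commute)

text \<open>Regularity comes from splitting sinh into exponentials of u and -u; the latter is given
  its own coefficient sequence \<open>u'\<close> so that \<open>hfin_fcoef_exp\<close> applies to
  it. The mean vanishes by the choice of \<open>c_sh\<close>.\<close>

lemma X_sh_Hs0:
  assumes "v \<in> Hs m"
  shows "X_sh v \<in> Hs0 (m + 1)"
proof -
  define u where "u = Psi_sh v"
  define u' where "u' k = - u k" for k
  have u: "u \<in> Hs (m + 1)" using Psi_sh_Hs[OF assms] by (simp add: u_def)
  have u': "u' \<in> Hs (m + 1)" using Hs_lincomb[OF u u, of "-1" 0] by (simp add: u'_def[abs_def])
  have fu': "fseries u' x = - fseries u x" for x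
    using fseries_lincomb[OF u u, of "-1" 0 x] by (simp add: u'_def[abs_def])
  have cu: "continuous_on {0..1} (fseries u)" by (rule continuous_on_fseries_Hs[OF u]) simp
  have "X_sh v = fcoef (\<lambda>x. 1 / 4 * exp (fseries u x) + - 1 / 4 * exp (fseries u' x))"
    unfolding X_sh_def u_def[symmetric] by (simp add: sinh_field_def fu' field_simps)
  also have "\<dots> = (\<lambda>k. complex_of_real (1 / 4) * fcoef (\<lambda>x. exp (fseries u x)) k
      + complex_of_real (- 1 / 4) * fcoef (\<lambda>x. exp (fseries u' x)) k)"
    by (subst fcoef_add[THEN ext])
       (auto simp only: fcoef_scale fu' intro!: continuous_intros cu)
  finally have eq: "X_sh v = \<dots>" .
  have "hfin (m + 1) (X_sh v)"
    unfolding eq using u u' by (intro hfin_add hfin_scale hfin_fcoef_exp) (auto simp: Hs_iff)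
  moreover have "real_seq (X_sh v)" unfolding X_sh_def by (rule real_seq_fcoef)
  moreover have "sinh_seq u 0 = 0"
    unfolding sinh_seq_def using intT_sinh_Psi_sh[OF assms]
    by (subst fcoef_zero) (auto simp: u_def[symmetric] intro!: continuous_intros cu)
  ultimately show ?thesis using sinh_seq_Psi_sh[OF assms, of 0] by (simp add: Hs0_iff u_def)
qed

text \<open>Surjectivity: u is determined by u_x up to its mean c, and since u has vanishing mean of
  sinh, uniqueness of the normalizing constant forces c to be \<open>c_sh\<close> of u_x /
  2.\<close>

lemma Psi_sh_dx_half:
  assumes "u \<in> M_sh (m + 1)"
  shows "(\<lambda>k. dx u k / 2) \<in> Hs0 m" and "Psi_sh (\<lambda>k. dx u k / 2) = u"
proof -
  have u: "u \<in> Hs (m + 1)" and s0: "intT (\<lambda>x. sinh (fseries u x)) = 0"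
    using assms by (auto simp: M_sh_def)
  define v where "v = (\<lambda>k. dx u k / 2)"
  have "dx u \<in> Hs m" "dx u 0 = 0" using dx_Hs0[OF u] by (auto simp: Hs0_def)
  thus v: "v \<in> Hs0 m" using Hs_lincomb[of "dx u" m "dx u" "1/2" 0] by (simp add: v_def Hs0_def)
  hence vm: "v \<in> Hs m" by (rule Hs0_Hs)
  define c where "c = Re (u 0)"
  have "cnj (u 0) = u 0" using u by (auto simp: Hs_iff real_seq_def dest: spec[of _ 0])
  hence u0: "u 0 = complex_of_real c" by (simp add: c_def complex_eq_iff)
  have av: "2 * antider v k = (if k = 0 then 0 else u k)" for k
    by (auto simp: v_def antider_def dx_def)
  have ueq: "u = (\<lambda>k. complex_of_real 2 * antider v k + complex_of_real 1 * (if k = 0 then complex_of_real c else 0))"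
    using av u0 by (auto simp: fun_eq_iff)
  have fu: "fseries u x = 2 * fseries (antider v) x + c" for x
    using fseries_lincomb[OF antider_Hs[OF vm] Hs_const, of 2 1 c x]
    unfolding ueq[symmetric] by (simp add: fseries_const)
  have cc: "continuous_on {0..1} (\<lambda>x. 2 * fseries (antider v) x)"
    by (intro continuous_intros continuous_on_fseries_antider[OF vm])
  have "c = c_sh v"
    using s0 intT_sinh_eq_0_iff[OF cc, of c] by (simp add: fu c_sh_eq[OF vm] expint_def)
  hence "Psi_sh v = (\<lambda>k. 2 * antider v k + (if k = 0 then complex_of_real c else 0))"
    by (simp add: Psi_sh_def fun_eq_iff)
  also have "\<dots> = u" by (subst ueq) simp
  finally show "Psi_sh v = u" .
qed

lemma dx_Psi_sh: "v 0 = 0 \<Longrightarrow> dx (Psi_sh v) k / 2 = v k"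
  by (auto simp: dx_def Psi_sh_def antider_def)

lemma bij_betw_Psi_sh: "bij_betw Psi_sh (Hs0 m) (M_sh (m + 1))"
proof (rule bij_betw_byWitness[where f'="\<lambda>u k. dx u k / 2"])
  show "\<forall>v\<in>Hs0 m. (\<lambda>k. dx (Psi_sh v) k / 2) = v"
    using dx_Psi_sh by (auto simp: Hs0_def)
  show "Psi_sh ` Hs0 m \<subseteq> M_sh (m + 1)"
    using Psi_sh_Hs[OF Hs0_Hs] intT_sinh_Psi_sh[OF Hs0_Hs] by (auto simp: M_sh_def)
qed (use Psi_sh_dx_half in auto)

subsection \<open>Differentiability\<close>

text \<open>This is \<open>has_L2grad\<close> with the pairing replaced by an arbitrary functional
  \<open>p\<close>, so that derivatives can be computed before a gradient is known. Bounds and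
  linearity of \<open>p\<close> are supplied separately in the chain rules.\<close>

definition has_hfderiv :: "fseq set \<Rightarrow> nat \<Rightarrow> (fseq \<Rightarrow> real) \<Rightarrow> fseq \<Rightarrow> (fseq \<Rightarrow> real) \<Rightarrow> bool" where
  "has_hfderiv E m P v p \<longleftrightarrow>
     (\<forall>\<epsilon>>0. \<exists>\<delta>>0. \<forall>h\<in>E. hnorm m h < \<delta> \<longrightarrow>
        \<bar>P (sadd v h) - P v - p h\<bar> \<le> \<epsilon> * hnorm m h)"

lemma has_hfderivD:
  assumes "has_hfderiv E m P v p" "\<epsilon> > 0"
  obtains \<delta> where "\<delta> > 0" "\<And>h. h \<in> E \<Longrightarrow> hnorm m h < \<delta> \<Longrightarrow> \<bar>P (sadd v h) - P v - p h\<bar> \<le> \<epsilon> * hnorm m h"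
  using assms unfolding has_hfderiv_def by blast

lemma DERIV_linear_approx:
  fixes \<phi> :: "real \<Rightarrow> real"
  assumes "DERIV \<phi> x :> d" "\<epsilon> > 0"
  obtains \<eta> where "\<eta> > 0" "\<And>y. \<bar>y - x\<bar> < \<eta> \<Longrightarrow> \<bar>\<phi> y - \<phi> x - d * (y - x)\<bar> \<le> \<epsilon> * \<bar>y - x\<bar>"
proof -
  have "(\<phi> has_derivative (\<lambda>h. d * h)) (at x)" using assms(1) by (simp add: has_field_derivative_def)
  hence "\<exists>\<eta>>0. \<forall>y. norm (y - x) < \<eta> \<longrightarrow> norm (\<phi> y - \<phi> x - d * (y - x)) \<le> \<epsilon> * norm (y - x)"
    using assms(2) by (simp add: has_derivative_at_alt)
  thus ?thesis using that by auto
qed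

lemma has_hfderiv_chain:
  assumes P: "has_hfderiv E m P v p" and K: "\<And>h. h \<in> E \<Longrightarrow> \<bar>p h\<bar> \<le> K * hnorm m h" "K \<ge> 0"
    and \<phi>: "DERIV \<phi> (P v) :> d"
  shows "has_hfderiv E m (\<lambda>v. \<phi> (P v)) v (\<lambda>h. d * p h)"
  unfolding has_hfderiv_def
proof (intro allI impI)
  fix \<epsilon> :: real assume e: "\<epsilon> > 0"
  \<comment> \<open>Each of the two errors, that of \<phi> and that of \<open>P\<close>, may
    contribute half of \<epsilon>. The cap of \<open>e2\<close> at 1 yields the Lipschitz bound
    \<open>K + 1\<close> for \<open>P\<close> at v, which enters \<open>e1\<close>.\<close>
  define e1 e2 where "e1 = \<epsilon> / (2 * (K + 1))" and "e2 = min 1 (\<epsilon> / (2 * (\<bar>d\<bar> + 1)))"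
  have e12: "e1 > 0" "e2 > 0" "e2 \<le> 1" using e K(2) by (auto simp: e1_def e2_def)
  obtain \<eta> where \<eta>: "\<eta> > 0" "\<And>y. \<bar>y - P v\<bar> < \<eta> \<Longrightarrow> \<bar>\<phi> y - \<phi> (P v) - d * (y - P v)\<bar> \<le> e1 * \<bar>y - P v\<bar>"
    using DERIV_linear_approx[OF \<phi> e12(1)] by blast
  obtain \<delta> where \<delta>: "\<delta> > 0" "\<And>h. h \<in> E \<Longrightarrow> hnorm m h < \<delta> \<Longrightarrow> \<bar>P (sadd v h) - P v - p h\<bar> \<le> e2 * hnorm m h"
    using has_hfderivD[OF P e12(2)] by blast
  show "\<exists>\<delta>>0. \<forall>h\<in>E. hnorm m h < \<delta> \<longrightarrow> \<bar>\<phi> (P (sadd v h)) - \<phi> (P v) - d * p h\<bar> \<le> \<epsilon> * hnorm m h"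
  proof (intro exI[of _ "min \<delta> (\<eta> / (K + 1))"] conjI ballI impI)
    show "0 < min \<delta> (\<eta> / (K + 1))" using \<eta>(1) \<delta>(1) K(2) by auto
    fix h assume h: "h \<in> E" "hnorm m h < min \<delta> (\<eta> / (K + 1))"
    define y where "y = P (sadd v h)"
    have r: "\<bar>y - P v - p h\<bar> \<le> e2 * hnorm m h" using \<delta>(2)[of h] h by (simp add: y_def)
    also have "\<dots> \<le> 1 * hnorm m h" using e12(3) by (intro mult_right_mono) auto
    finally have yb: "\<bar>y - P v\<bar> \<le> (K + 1) * hnorm m h"
      using K(1)[OF h(1)] by (simp add: algebra_simps)
    also have "\<dots> < \<eta>" using h(2) K(2) by (simp add: field_simps)
    finally have "\<bar>\<phi> y - \<phi> (P v) - d * (y - P v)\<bar> \<le> e1 * \<bar>y - P v\<bar>" by (rule \<eta>(2))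
    also have "\<dots> \<le> e1 * ((K + 1) * hnorm m h)" using yb e12 by (intro mult_left_mono) auto
    also have "\<dots> = \<epsilon> / 2 * hnorm m h" using K(2) by (simp add: e1_def field_simps)
    finally have 1: "\<bar>\<phi> y - \<phi> (P v) - d * (y - P v)\<bar> \<le> \<epsilon> / 2 * hnorm m h" .
    have "\<bar>d\<bar> * \<bar>y - P v - p h\<bar> \<le> (\<bar>d\<bar> + 1) * (\<epsilon> / (2 * (\<bar>d\<bar> + 1)) * hnorm m h)"
      using r by (intro mult_mono order_trans[OF r] mult_right_mono) (auto simp: e2_def)
    also have "\<dots> = \<epsilon> / 2 * hnorm m h" by (simp add: field_simps)
    finally have 2: "\<bar>d * (y - P v) - d * p h\<bar> \<le> \<epsilon> / 2 * hnorm m h"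
      by (simp add: abs_mult[symmetric] right_diff_distrib)
    show "\<bar>\<phi> (P (sadd v h)) - \<phi> (P v) - d * p h\<bar> \<le> \<epsilon> * hnorm m h"
      using 1 2 unfolding y_def[symmetric] by linarith
  qed
qed

lemma has_hfderiv_add:
  assumes "has_hfderiv E m P v p" "has_hfderiv E m Q v q"
  shows "has_hfderiv E m (\<lambda>v. P v + Q v) v (\<lambda>h. p h + q h)"
  unfolding has_hfderiv_def
proof (intro allI impI)
  fix \<epsilon> :: real assume "\<epsilon> > 0"
  hence e: "\<epsilon> / 2 > 0" by simp
  obtain \<delta>1 where \<delta>1: "\<delta>1 > 0" "\<And>h. h \<in> E \<Longrightarrow> hnorm m h < \<delta>1 \<Longrightarrow> \<bar>P (sadd v h) - P v - p h\<bar> \<le> \<epsilon> / 2 * hnorm m h"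
    using has_hfderivD[OF assms(1) e] by blast
  obtain \<delta>2 where \<delta>2: "\<delta>2 > 0" "\<And>h. h \<in> E \<Longrightarrow> hnorm m h < \<delta>2 \<Longrightarrow> \<bar>Q (sadd v h) - Q v - q h\<bar> \<le> \<epsilon> / 2 * hnorm m h"
    using has_hfderivD[OF assms(2) e] by blast
  show "\<exists>\<delta>>0. \<forall>h\<in>E. hnorm m h < \<delta> \<longrightarrow>
      \<bar>P (sadd v h) + Q (sadd v h) - (P v + Q v) - (p h + q h)\<bar> \<le> \<epsilon> * hnorm m h"
  proof (intro exI[of _ "min \<delta>1 \<delta>2"] conjI ballI impI)
    fix h assume "h \<in> E" "hnorm m h < min \<delta>1 \<delta>2"
    with \<delta>1(2)[of h] \<delta>2(2)[of h]
    have "\<bar>P (sadd v h) - P v - p h\<bar> \<le> \<epsilon> * hnorm m h / 2" "\<bar>Q (sadd v h) - Q v - q h\<bar> \<le> \<epsilon> * hnorm m h / 2"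
      by simp_all
    thus "\<bar>P (sadd v h) + Q (sadd v h) - (P v + Q v) - (p h + q h)\<bar> \<le> \<epsilon> * hnorm m h"
      by linarith
  qed (use \<delta>1 \<delta>2 in auto)
qed

text \<open>The difference quotients q of \<gamma> converge to d in norm. The error splits into the
  remainder of \<open>P\<close>, which is small relative to the bounded norm of q, and p (q - d),
  which is small because p is bounded.\<close>

lemma DERIV_along_curve:
  assumes P: "has_hfderiv (Hs m) m P (\<gamma> t) p"
    and K: "\<And>h. h \<in> Hs m \<Longrightarrow> \<bar>p h\<bar> \<le> K * hnorm m h" "K \<ge> 0"
    and lin: "\<And>c d a b. c \<in> Hs m \<Longrightarrow> d \<in> Hs m \<Longrightarrow>
        p (\<lambda>k. complex_of_real a * c k + complex_of_real b * d k) = a * p c + b * p d"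
    and \<gamma>: "\<gamma> t \<in> Hs m" "\<forall>\<^sub>F s in at t. \<gamma> s \<in> Hs m" and d: "d \<in> Hs m" "has_hderiv m \<gamma> d t"
  shows "((\<lambda>s. P (\<gamma> s)) has_real_derivative p d) (at t)"
  unfolding has_field_derivative_iff
proof (rule tendstoI)
  fix e :: real assume e: "e > 0"
  \<comment> \<open>Eventually the difference quotients have norm below
    \<open>hnorm m d + 1\<close>, so this choice makes the remainder less than e / 2.\<close>
  define \<epsilon> where "\<epsilon> = e / (2 * (hnorm m d + 1))"
  have dp: "hnorm m d + 1 > 0" using hnorm_nonneg[of m d] by linarith
  have \<epsilon>: "\<epsilon> > 0" using e dp by (simp add: \<epsilon>_def)
  obtain \<delta> where \<delta>: "\<delta> > 0" "\<And>h. h \<in> Hs m \<Longrightarrow> hnorm m h < \<delta> \<Longrightarrow> \<bar>P (sadd (\<gamma> t) h) - P (\<gamma> t) - p h\<bar> \<le> \<epsilon> * hnorm m h"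
    using has_hfderivD[OF P \<epsilon>] by blast
  define r where "r s = hnorm m (\<lambda>k. (\<gamma> s k - \<gamma> t k) / complex_of_real (s - t) - d k)" for s
  have r: "(r \<longlongrightarrow> 0) (at t)" using d(2) unfolding has_hderiv_def r_def[abs_def] .
  have ev1: "\<forall>\<^sub>F s in at t. r s < min 1 (e / (2 * (K + 1)))"
    using r e K(2) by (intro order_tendstoD) auto
  have "((\<lambda>s. \<bar>s - t\<bar> * (hnorm m d + 1)) \<longlongrightarrow> \<bar>t - t\<bar> * (hnorm m d + 1)) (at t)"
    by (intro tendsto_intros)
  hence ev2: "\<forall>\<^sub>F s in at t. \<bar>s - t\<bar> * (hnorm m d + 1) < \<delta>"
    using \<delta>(1) by (intro order_tendstoD) auto
  have ev3: "\<forall>\<^sub>F s in at t. s \<noteq> t" by (simp add: eventually_at_filter)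
  show "\<forall>\<^sub>F s in at t. dist ((P (\<gamma> s) - P (\<gamma> t)) / (s - t)) (p d) < e"
    using ev1 ev2 ev3 \<gamma>(2)
  proof eventually_elim
    case (elim s)
    \<comment> \<open>The increment h, the quotient q and the error z = q - d are written as
      two-term combinations, with trivial coefficients where necessary, so that
      \<open>Hs_lincomb\<close> and \<open>lin\<close> apply to them.\<close>
    define h where "h = (\<lambda>k. complex_of_real 1 * \<gamma> s k + complex_of_real (-1) * \<gamma> t k)"
    define q where "q = (\<lambda>k. complex_of_real (1 / (s - t)) * h k + complex_of_real 0 * h k)"
    define z where "z = (\<lambda>k. complex_of_real 1 * q k + complex_of_real (-1) * d k)"
    have h: "h \<in> Hs m" unfolding h_def by (intro Hs_lincomb elim \<gamma>)
    have q: "q \<in> Hs m" unfolding q_def by (intro Hs_lincomb h)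
    have z: "z \<in> Hs m" unfolding z_def by (intro Hs_lincomb q d)
    have ph: "p h = (s - t) * p q"
      using lin[OF h h, of "1 / (s - t)" 0] elim by (simp add: q_def)
    have pz: "p z = p q - p d" using lin[OF q d(1), of 1 "-1"] by (simp add: z_def)
    have rz: "r s = hnorm m z" by (simp add: r_def z_def q_def h_def field_simps)
    have "hnorm m q \<le> hnorm m z + hnorm m d"
      using hnorm_add[of m z d] z d by (simp add: z_def Hs_iff)
    hence qb: "hnorm m q \<le> hnorm m d + 1" "hnorm m q < hnorm m d + 1" using elim rz by auto
    have "h = (\<lambda>k. complex_of_real (s - t) * q k)" using elim by (auto simp: q_def)
    hence hq: "hnorm m h = \<bar>s - t\<bar> * hnorm m q" by (simp only: hnorm_scale norm_of_real)
    also have "\<dots> \<le> \<bar>s - t\<bar> * (hnorm m d + 1)" using qb by (intro mult_left_mono) auto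
    also have "\<dots> < \<delta>" by (rule elim)
    finally have "\<bar>P (sadd (\<gamma> t) h) - P (\<gamma> t) - p h\<bar> \<le> \<epsilon> * hnorm m h" using \<delta>(2) h by blast
    moreover have "sadd (\<gamma> t) h = \<gamma> s" by (auto simp: sadd_def h_def)
    ultimately have "\<bar>P (\<gamma> s) - P (\<gamma> t) - (s - t) * p q\<bar> \<le> \<bar>s - t\<bar> * (\<epsilon> * hnorm m q)"
      by (simp add: ph hq algebra_simps)
    moreover have "P (\<gamma> s) - P (\<gamma> t) - (s - t) * p q = (s - t) * ((P (\<gamma> s) - P (\<gamma> t)) / (s - t) - p q)"
      using elim by (simp add: field_simps)
    ultimately have 1: "\<bar>(P (\<gamma> s) - P (\<gamma> t)) / (s - t) - p q\<bar> \<le> \<epsilon> * hnorm m q"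
      using elim by (simp add: abs_mult)
    have "\<epsilon> * hnorm m q < \<epsilon> * (hnorm m d + 1)" using qb \<epsilon> by simp
    also have "\<dots> = e / 2" using less_imp_neq[OF dp] unfolding \<epsilon>_def by (metis divide_divide_eq_left nonzero_eq_divide_eq mult.commute)
    finally have 2: "\<epsilon> * hnorm m q < e / 2" .
    have "\<bar>p q - p d\<bar> \<le> K * hnorm m z" using K(1)[OF z] pz by simp
    also have "\<dots> \<le> (K + 1) * (e / (2 * (K + 1)))" using elim rz K(2) by (intro mult_mono) auto
    also have "\<dots> = e / 2" using K(2) by (simp add: field_simps)
    finally show ?case using 1 2 unfolding dist_real_def by linarith
  qed
qed

section \<open>Derivatives of the exponential integrals and of the Hamiltonian\<close>

lemma abs_intT_mult_le:
  assumes "continuous_on {0..1} f" "continuous_on {0..1} g" "\<And>x. f x \<ge> 0" "\<And>x. \<bar>g x\<bar> \<le> B"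
  shows "\<bar>intT (\<lambda>x. f x * g x)\<bar> \<le> B * intT f"
proof -
  have "norm (integral {0..1} (\<lambda>x. f x * g x)) \<le> integral {0..1} (\<lambda>x. B * f x)"
  proof (rule integral_norm_bound_integral)
    fix x show "norm (f x * g x) \<le> B * f x"
      using mult_left_mono[OF assms(4)[of x] assms(3)[of x]] assms(3)[of x] by (simp add: abs_mult mult.commute)
  qed (intro integrable_continuous_interval continuous_intros assms)+
  thus ?thesis by (simp add: intT_def)
qed

definition dexpint :: "real \<Rightarrow> fseq \<Rightarrow> fseq \<Rightarrow> real" where
  "dexpint a v h = a * intT (\<lambda>x. exp (a * fseries (antider v) x) * fseries (antider h) x)"

lemma abs_fseries_antider_le: "h \<in> Hs m \<Longrightarrow> \<bar>fseries (antider h) x\<bar> \<le> embed_const * hnorm m h"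
  using abs_fseries_le[of "antider h" "m + 1" x] antider_Hs[of h m] hnorm_antider[of h m]
    mult_left_mono[OF _ embed_const_nonneg] by (fastforce simp: Hs_iff)

lemma fseries_antider_lincomb:
  assumes "c \<in> Hs m" "d \<in> Hs m"
  shows "fseries (antider (\<lambda>k. complex_of_real a * c k + complex_of_real b * d k)) x
           = a * fseries (antider c) x + b * fseries (antider d) x"
  unfolding antider_lincomb by (rule fseries_lincomb[OF antider_Hs[OF assms(1)] antider_Hs[OF assms(2)]]) simp

lemma fseries_antider_sadd:
  assumes "c \<in> Hs m" "d \<in> Hs m"
  shows "fseries (antider (sadd c d)) x = fseries (antider c) x + fseries (antider d) x"
  using fseries_antider_lincomb[OF assms, of 1 1 x] by (simp add: sadd_def)

lemma dexpint_bound: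
  assumes "v \<in> Hs m" "h \<in> Hs m"
  shows "\<bar>dexpint a v h\<bar> \<le> \<bar>a\<bar> * embed_const * expint a v * hnorm m h"
proof -
  have "\<bar>intT (\<lambda>x. exp (a * fseries (antider v) x) * fseries (antider h) x)\<bar>
      \<le> embed_const * hnorm m h * expint a v"
    unfolding expint_def
    by (intro abs_intT_mult_le abs_fseries_antider_le continuous_intros continuous_on_fseries_antider[OF assms(1)]
        continuous_on_fseries_antider[OF assms(2)] assms) auto
  from mult_left_mono[OF this, of "\<bar>a\<bar>"] show ?thesis by (simp add: dexpint_def abs_mult mult_ac)
qed

lemma dexpint_lincomb:
  assumes "v \<in> Hs m" "c \<in> Hs m" "d \<in> Hs m"
  shows "dexpint a v (\<lambda>k. complex_of_real b * c k + complex_of_real b' * d k)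
           = b * dexpint a v c + b' * dexpint a v d"
proof -
  let ?f = "\<lambda>h x. exp (a * fseries (antider v) x) * fseries (antider h) x"
  have i: "?f h integrable_on {0..1}" if "h \<in> Hs m" for h
    by (intro integrable_continuous_interval continuous_intros continuous_on_fseries_antider[OF assms(1)]
        continuous_on_fseries_antider[OF that])
  have "((\<lambda>x. b * ?f c x + b' * ?f d x) has_integral (b * intT (?f c) + b' * intT (?f d))) {0..1}"
    unfolding intT_def by (intro has_integral_add has_integral_mult_right integrable_integral i assms)
  hence "intT (\<lambda>x. b * ?f c x + b' * ?f d x) = b * intT (?f c) + b' * intT (?f d)"
    by (simp add: intT_def integral_unique)
  thus ?thesis unfolding dexpint_def fseries_antider_lincomb[OF assms(2,3)]
    by (simp add: algebra_simps)
qed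

text \<open>The exponential of the sum factors, so the remainder is the integral of \<open>f\<close>
  times exp g - 1 - g. The embedding bounds g uniformly by a multiple of the norm of h, which
  reduces everything to the scalar derivative of exp at 0.\<close>

lemma has_hfderiv_expint:
  assumes v: "v \<in> Hs m"
  shows "has_hfderiv (Hs m) m (expint a) v (dexpint a v)"
  unfolding has_hfderiv_def
proof (intro allI impI)
  fix \<epsilon> :: real assume e: "\<epsilon> > 0"
  define A where "A = \<bar>a\<bar> * embed_const"
  have A: "A \<ge> 0" by (simp add: A_def embed_const_nonneg)
  \<comment> \<open>The remainder is integrated against a density of mass \<open>expint a v\<close>,
    and g is bounded by \<open>A * hnorm m h\<close>; both constants are divided out here, with
    \<open>A + 1\<close> in place of \<open>A\<close> to avoid a zero denominator.\<close>
  define e1 where "e1 = \<epsilon> / ((A + 1) * expint a v)"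
  have Z: "expint a v > 0" by (rule expint_pos[OF v])
  have e1: "e1 > 0" using e A Z by (simp add: e1_def)
  have "DERIV exp 0 :> (1::real)" using DERIV_exp[of "0::real"] by simp
  from DERIV_linear_approx[OF this e1]
  obtain \<eta> where \<eta>: "\<eta> > 0" "\<And>y::real. \<bar>y\<bar> < \<eta> \<Longrightarrow> \<bar>exp y - 1 - y\<bar> \<le> e1 * \<bar>y\<bar>"
    by auto
  show "\<exists>\<delta>>0. \<forall>h\<in>Hs m. hnorm m h < \<delta> \<longrightarrow>
      \<bar>expint a (sadd v h) - expint a v - dexpint a v h\<bar> \<le> \<epsilon> * hnorm m h"
  proof (intro exI[of _ "\<eta> / (A + 1)"] conjI ballI impI)
    show "\<eta> / (A + 1) > 0" using \<eta> A by simp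
    fix h assume h: "h \<in> Hs m" and hb: "hnorm m h < \<eta> / (A + 1)"
    define f g where "f x = exp (a * fseries (antider v) x)" and "g x = a * fseries (antider h) x" for x
    have cf: "continuous_on {0..1} f" and cg: "continuous_on {0..1} g"
      unfolding f_def g_def
      by (intro continuous_intros continuous_on_fseries_antider[OF v] continuous_on_fseries_antider[OF h])+
    have gb: "\<bar>g x\<bar> \<le> A * hnorm m h" for x
      using mult_left_mono[OF abs_fseries_antider_le[OF h, of x], of "\<bar>a\<bar>"] by (simp add: g_def A_def abs_mult mult.assoc)
    have "A * hnorm m h \<le> (A + 1) * hnorm m h" by (simp add: algebra_simps)
    also have "\<dots> < \<eta>" using hb A by (simp add: field_simps)
    finally have "\<bar>g x\<bar> < \<eta>" for x using gb[of x] by linarith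
    hence "\<bar>exp (g x) - 1 - g x\<bar> \<le> e1 * \<bar>g x\<bar>" for x using \<eta>(2) by blast
    hence b: "\<bar>exp (g x) - 1 - g x\<bar> \<le> e1 * (A * hnorm m h)" for x
      using mult_left_mono[OF gb[of x], of e1] e1 by (meson less_imp_le order_trans)
    have "((\<lambda>x. f x * exp (g x)) has_integral intT (\<lambda>x. f x * exp (g x))) {0..1}"
      "(f has_integral intT f) {0..1}" "((\<lambda>x. f x * g x) has_integral intT (\<lambda>x. f x * g x)) {0..1}"
      unfolding intT_def by (intro integrable_integral integrable_continuous_interval continuous_intros cf cg)+
    from has_integral_diff[OF has_integral_diff[OF this(1,2)] this(3)]
    have "intT (\<lambda>x. f x * (exp (g x) - 1 - g x)) = intT (\<lambda>x. f x * exp (g x)) - intT f - intT (\<lambda>x. f x * g x)"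
      by (simp add: intT_def integral_unique algebra_simps)
    moreover have "intT (\<lambda>x. f x * exp (g x)) = expint a (sadd v h)"
      by (simp add: expint_def fseries_antider_sadd[OF v h] f_def g_def exp_add distrib_left)
    moreover have "intT f = expint a v" by (simp add: expint_def f_def[abs_def])
    moreover have "intT (\<lambda>x. f x * g x) = dexpint a v h"
      by (simp add: dexpint_def f_def g_def intT_def mult.left_commute)
    ultimately have "\<bar>expint a (sadd v h) - expint a v - dexpint a v h\<bar>
        = \<bar>intT (\<lambda>x. f x * (exp (g x) - 1 - g x))\<bar>" by simp
    also have "\<dots> \<le> e1 * (A * hnorm m h) * intT f"
      by (intro abs_intT_mult_le b continuous_intros cf cg) (simp add: f_def)
    also have "\<dots> \<le> e1 * ((A + 1) * hnorm m h) * intT f"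
      using e1 A Z by (intro mult_right_mono mult_left_mono) (auto simp: \<open>intT f = expint a v\<close> mult_right_mono)
    also have "\<dots> = \<epsilon> * hnorm m h" using A Z by (simp add: e1_def \<open>intT f = expint a v\<close>)
    finally show "\<bar>expint a (sadd v h) - expint a v - dexpint a v h\<bar> \<le> \<epsilon> * hnorm m h" .
  qed
qed

text \<open>The value of the derivative is left existential: it becomes the zero mode of u_t, which
  differentiation in x removes.\<close>

lemma DERIV_c_sh_curve:
  assumes "\<gamma> t \<in> Hs m" "\<forall>\<^sub>F s in at t. \<gamma> s \<in> Hs m" "d \<in> Hs m" "has_hderiv m \<gamma> d t"
  obtains c' where "((\<lambda>s. c_sh (\<gamma> s)) has_real_derivative c') (at t)"
proof -
  have D: "((\<lambda>s. expint a (\<gamma> s)) has_real_derivative dexpint a (\<gamma> t) d) (at t)" for a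
    by (rule DERIV_along_curve[OF has_hfderiv_expint dexpint_bound _ dexpint_lincomb])
       (use assms expint_pos[of "\<gamma> t" m a] embed_const_nonneg in auto)
  have L: "((\<lambda>s. ln (expint a (\<gamma> s))) has_real_derivative 1 / expint a (\<gamma> t) * dexpint a (\<gamma> t) d) (at t)" for a
    by (rule DERIV_chain2[OF DERIV_ln_divide D]) (rule expint_pos[OF assms(1)])
  have D': "((\<lambda>s. (ln (expint (-2) (\<gamma> s)) - ln (expint 2 (\<gamma> s))) / 2) has_real_derivative
      (1 / expint (-2) (\<gamma> t) * dexpint (-2) (\<gamma> t) d - 1 / expint 2 (\<gamma> t) * dexpint 2 (\<gamma> t) d) / 2) (at t)"
    by (intro DERIV_cdivide DERIV_diff L)
  have ev: "\<forall>\<^sub>F s in nhds t. (ln (expint (-2) (\<gamma> s)) - ln (expint 2 (\<gamma> s))) / 2 = c_sh (\<gamma> s)"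
    using assms(1,2) unfolding eventually_nhds_conv_at by (auto elim!: eventually_mono simp: c_sh_eq[of _ m])
  show ?thesis by (rule that[OF iffD1[OF DERIV_cong_ev[OF refl ev refl] D']])
qed

text \<open>With e the square root of P Q, the derivative of - e / 4 is - e / 8 times (dP / P + dQ /
  Q). Since e / P = exp c and e / Q = exp (- c), this is minus half the integral of z sinh u, where
  z is the antiderivative of h. Skew-symmetry of \<open>antider\<close> moves it from h to
  \<open>X_sh v\<close> and absorbs the sign.\<close>

lemma has_L2grad_H_sh:
  assumes v: "v \<in> Hs m"
  shows "has_L2grad (Hs m) m H_sh v (antider (X_sh v))"
proof -
  define P Q where "P = expint 2 v" and "Q = expint (-2) v"
  define e where "e = exp ((ln P + ln Q) / 2)"
  have pos: "P > 0" "Q > 0" using expint_pos[OF v] by (auto simp: P_def Q_def)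
  have ln: "has_hfderiv (Hs m) m (\<lambda>v. ln (expint a v)) v (\<lambda>h. (1 / expint a v) * dexpint a v h)" for a
    by (rule has_hfderiv_chain[OF has_hfderiv_expint[OF v] dexpint_bound[OF v]])
       (use expint_pos[OF v, of a] embed_const_nonneg in \<open>auto intro!: derivative_eq_intros\<close>)
  have b: "\<bar>1 / expint a v * dexpint a v h\<bar> \<le> 2 * embed_const * hnorm m h"
    if "h \<in> Hs m" "\<bar>a\<bar> = 2" for a h
    using dexpint_bound[OF v that(1), of a] expint_pos[OF v, of a] that(2)
    by (simp add: abs_mult field_simps)
  have D: "has_hfderiv (Hs m) m (\<lambda>v. - 1 / 4 * exp ((ln (expint 2 v) + ln (expint (-2) v)) / 2)) v
     (\<lambda>h. (- 1 / 8 * e) * (1 / P * dexpint 2 v h + 1 / Q * dexpint (-2) v h))"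
    unfolding P_def Q_def
  proof (rule has_hfderiv_chain[OF has_hfderiv_add[OF ln[of 2] ln[of "-2"]], where K="4 * embed_const"])
    fix h assume "h \<in> Hs m"
    from b[OF this, of 2] b[OF this, of "-2"]
    show "\<bar>1 / expint 2 v * dexpint 2 v h + 1 / expint (- 2) v * dexpint (- 2) v h\<bar>
        \<le> 4 * embed_const * hnorm m h" by linarith
  next
    show "((\<lambda>y. - 1 / 4 * exp (y / 2)) has_real_derivative - 1 / 8 * e) (at (ln (expint 2 v) + ln (expint (- 2) v)))"
      by (auto intro!: derivative_eq_intros simp: e_def P_def Q_def)
  qed (use embed_const_nonneg in auto)
  define u where "u x = fseries (Psi_sh v) x" for x
  have ec: "e / P = exp (c_sh v)" "e / Q = exp (- c_sh v)"
  proof -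
    have "e / exp (ln P) = exp (c_sh v)" "e / exp (ln Q) = exp (- c_sh v)"
      unfolding e_def exp_diff[symmetric] c_sh_eq[OF v] P_def Q_def by (simp_all add: field_simps)
    thus "e / P = exp (c_sh v)" "e / Q = exp (- c_sh v)" using pos by simp_all
  qed
  have pair: "l2pair (antider (X_sh v)) h = (- 1 / 8 * e) * (1 / P * dexpint 2 v h + 1 / Q * dexpint (-2) v h)"
    if h: "h \<in> Hs m" for h
  proof -
    let ?w = "fseries (antider v)" and ?z = "fseries (antider h)"
    have cu: "continuous_on {0..1} u" unfolding u_def[abs_def]
      by (rule continuous_on_fseries_Hs[OF Psi_sh_Hs[OF v]]) simp
    have cz: "continuous_on {0..1} ?z" and cw: "continuous_on {0..1} ?w"
      by (rule continuous_on_fseries_antider[OF h] continuous_on_fseries_antider[OF v])+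
    have i: "((\<lambda>x. exp (a * ?w x) * ?z x) has_integral intT (\<lambda>x. exp (a * ?w x) * ?z x)) {0..1}" for a
      unfolding intT_def by (intro integrable_integral integrable_continuous_interval continuous_intros cz cw)
    have "((\<lambda>x. 1/2 * (exp (c_sh v) * (exp (2 * ?w x) * ?z x) - exp (- c_sh v) * (exp (-2 * ?w x) * ?z x)))
        has_integral (1/2 * (exp (c_sh v) * intT (\<lambda>x. exp (2 * ?w x) * ?z x)
           - exp (- c_sh v) * intT (\<lambda>x. exp (-2 * ?w x) * ?z x)))) {0..1}"
      by (intro has_integral_diff has_integral_mult_right i)
    moreover have "1/2 * (exp (c_sh v) * (exp (2 * ?w x) * ?z x) - exp (- c_sh v) * (exp (-2 * ?w x) * ?z x))
        = ?z x * sinh (u x)" for x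
    proof -
      have "exp (c_sh v) * exp (2 * ?w x) = exp (u x)" "exp (- c_sh v) * exp (-2 * ?w x) = exp (- u x)"
        unfolding exp_add[symmetric] u_def fseries_Psi_sh[OF v] by (simp_all add: add.commute)
      thus ?thesis unfolding sinh_field_def mult.assoc[symmetric] by (simp add: field_simps)
    qed
    ultimately have zs: "((\<lambda>x. ?z x * sinh (u x)) has_integral (1/2 * (exp (c_sh v) * intT (\<lambda>x. exp (2 * ?w x) * ?z x)
           - exp (- c_sh v) * intT (\<lambda>x. exp (-2 * ?w x) * ?z x)))) {0..1}"
      by simp
    have "(1/2 * (exp (c_sh v) * intT (\<lambda>x. exp (2 * ?w x) * ?z x)
           - exp (- c_sh v) * intT (\<lambda>x. exp (-2 * ?w x) * ?z x))) = 1/4 * e * (1 / P * dexpint 2 v h + 1 / Q * dexpint (-2) v h)"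
      unfolding ec[symmetric] dexpint_def by (simp add: field_simps)
    with has_integral_of_real[OF zs, where 'b=complex]
    have I: "integral {0..1} (\<lambda>x. complex_of_real (?z x) * complex_of_real (sinh (u x)))
        = complex_of_real (1/4 * e * (1 / P * dexpint 2 v h + 1 / Q * dexpint (-2) v h))" (is "_ = complex_of_real ?J")
      by (metis (no_types, lifting) integral_unique of_real_mult integral_cong)
    have ah: "real_seq (antider h)" "(\<lambda>k. cmod (antider h k)) summable_on UNIV"
      using antider_Hs[OF h] Hs_abs_summable[OF antider_Hs[OF h]] by (auto simp: Hs_iff)
    have "continuous_on {0..1} (\<lambda>x. complex_of_real (sinh (u x)))" by (intro continuous_intros cu)
    note S = integral_fseries_mult[OF ah this, unfolded I]
    have co: "integral {0..1} (\<lambda>x. fchar k x * complex_of_real (sinh (u x))) = 2 * cnj (X_sh v k)" for k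
    proof -
      have "integral {0..1} (\<lambda>x. fchar k x * complex_of_real (sinh (u x))) = sinh_seq (Psi_sh v) (- k)"
        by (simp add: sinh_seq_def fcoef_def u_def mult.commute)
      also have "\<dots> = 2 * X_sh v (- k)" by (rule sinh_seq_Psi_sh[OF v])
      also have "X_sh v (- k) = cnj (X_sh v k)"
        using X_sh_Hs0[OF v] by (simp add: Hs0_iff real_seq_def)
      finally show ?thesis .
    qed
    \<comment> \<open>The series S pairs \<open>antider h\<close> with 2 \<open>X_sh v\<close>.
      Conjugation exchanges the roles of the two arguments, and as the divisor 2 pi i k is imaginary
      it changes sign; the factor -1/2 corrects both the sign and the 2.\<close>
    have "((\<lambda>k. (- 1 / 2) * cnj (antider h k * (2 * cnj (X_sh v k)))) has_sum (- 1 / 2) * cnj (complex_of_real ?J)) UNIV"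
      using S unfolding co by (intro has_sum_cmult_right) (simp only: has_sum_cnj_iff)
    moreover have "(- 1 / 2) * cnj (antider h k * (2 * cnj (X_sh v k))) = antider (X_sh v) k * cnj (h k)" for k
      by (simp add: antider_def)
    ultimately have "infsum (\<lambda>k. antider (X_sh v) k * cnj (h k)) UNIV = complex_of_real (- 1 / 2 * ?J)"
      by (simp add: has_sum_iff)
    thus ?thesis unfolding l2pair_def by simp
  qed
  show ?thesis
    unfolding has_L2grad_def
  proof (intro allI impI)
    fix \<epsilon> :: real assume "\<epsilon> > 0"
    from has_hfderivD[OF D this] obtain \<delta> where \<delta>: "\<delta> > 0" and
      "\<And>h. h \<in> Hs m \<Longrightarrow> hnorm m h < \<delta> \<Longrightarrow>
        \<bar>- 1 / 4 * exp ((ln (expint 2 (sadd v h)) + ln (expint (-2) (sadd v h))) / 2)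
          - (- 1 / 4 * exp ((ln (expint 2 v) + ln (expint (-2) v)) / 2))
          - (- 1 / 8 * e) * (1 / P * dexpint 2 v h + 1 / Q * dexpint (-2) v h)\<bar> \<le> \<epsilon> * hnorm m h"
      by blast
    thus "\<exists>\<delta>>0. \<forall>h\<in>Hs m. hnorm m h < \<delta> \<longrightarrow>
        \<bar>H_sh (sadd v h) - H_sh v - l2pair (antider (X_sh v)) h\<bar> \<le> \<epsilon> * hnorm m h"
      by (intro exI[of _ \<delta>]) (auto simp only: H_sh_eq[OF v] H_sh_eq[OF sadd_Hs[OF v]] pair)
  qed
qed

section \<open>Transfer of solutions between the two equations\<close>

lemma Hs_order_mono: "c \<in> Hs s' \<Longrightarrow> s \<le> s' \<Longrightarrow> c \<in> Hs s"
  by (auto simp: Hs_iff hfin_order_mono)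

text \<open>The convergence of the difference quotients of v in order m passes through
  \<open>antider\<close> to order m + 1. What remains is the zero mode, a scalar difference quotient
  that converges by \<open>DERIV_c_sh_curve\<close>.\<close>

lemma solves_vsh_imp_solves_SG:
  assumes v: "solves_vsh m v a b"
  shows "solves_SG m (\<lambda>t. Psi_sh (v t)) a b"
  unfolding solves_SG_def
proof (intro ballI conjI)
  fix t assume t: "t \<in> {a<..<b}"
  have vt: "v t \<in> Hs m" and d: "has_hderiv m v (X_sh (v t)) t"
    using v t Hs0_Hs by (auto simp: solves_vsh_def)
  show "Psi_sh (v t) \<in> Hs (m + 1)" by (rule Psi_sh_Hs[OF vt])
  have ev: "\<forall>\<^sub>F s in at t. v s \<in> Hs m"
    using t v Hs0_Hs by (intro eventually_at_in_open'[of "{a<..<b}" t, THEN eventually_mono]) (auto simp: solves_vsh_def)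
  define X where "X = X_sh (v t)"
  have X1: "X \<in> Hs0 (m + 1)" using X_sh_Hs0[OF vt] by (simp add: X_def)
  have X: "X \<in> Hs m" using Hs_order_mono[OF Hs0_Hs[OF X1], of m] by simp
  obtain c' where c': "((\<lambda>s. c_sh (v s)) has_real_derivative c') (at t)"
    using DERIV_c_sh_curve[of v t m X] vt ev X d by (auto simp: X_def)
  \<comment> \<open>The derivative of \<open>Psi_sh\<close> along the curve: its linear part applied
    to \<open>X\<close>, with c' in the zero mode.\<close>
  define w where "w = (\<lambda>k. 2 * antider X k + (if k = 0 then complex_of_real c' else 0))"
  have w: "w \<in> Hs (m + 1)"
    using Hs_lincomb[OF antider_Hs[OF X] Hs_const, of 2 1 c'] by (simp add: w_def)
  have "dx w = sinh_seq (Psi_sh (v t))"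
    using X1 sinh_seq_Psi_sh[OF vt] by (auto simp: fun_eq_iff dx_def w_def antider_def X_def Hs0_def)
  moreover have "has_hderiv (m + 1) (\<lambda>t. Psi_sh (v t)) w t"
    unfolding has_hderiv_def
  proof (rule tendsto_sandwich[OF always_eventually _ tendsto_const])
    let ?r = "\<lambda>s. hnorm m (\<lambda>k. (v s k - v t k) / complex_of_real (s - t) - X k)"
    let ?c = "\<lambda>s. (c_sh (v s) - c_sh (v t)) / (s - t) - c'"
    show "\<forall>\<^sub>F s in at t. hnorm (m + 1) (\<lambda>k. (Psi_sh (v s) k - Psi_sh (v t) k) / complex_of_real (s - t) - w k)
        \<le> 2 * ?r s + \<bar>?c s\<bar>"
      using ev
    proof eventually_elim
      case (elim s)
      define q where "q = (\<lambda>k. (v s k - v t k) / complex_of_real (s - t) - X k)"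
      have "(\<lambda>k. complex_of_real 1 * v s k + complex_of_real (-1) * v t k) \<in> Hs m"
        by (intro Hs_lincomb elim vt)
      from Hs_lincomb[OF this X, of "1 / (s - t)" "-1"] have q: "q \<in> Hs m" by (simp add: q_def)
      have "(\<lambda>k. (Psi_sh (v s) k - Psi_sh (v t) k) / complex_of_real (s - t) - w k)
          = (\<lambda>k. 2 * antider q k + (if k = 0 then complex_of_real (?c s) else 0))"
      proof
        fix k
        \<comment> \<open>The multiplier of \<open>antider\<close> at the frequency k, equal to 0 at
          k = 0. It reduces the claim to a single algebraic identity without a case
          distinction.\<close>
        define z where "z = antider (\<lambda>_. 1) k"
        have z: "antider c k = c k * z" for c by (simp add: antider_def z_def)
        have alg: "(2 * (\<alpha> * z) + c1 - (2 * (\<beta> * z) + c2)) / D - (2 * (x * z) + c3)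
            = 2 * (((\<alpha> - \<beta>) / D - x) * z) + ((c1 - c2) / D - c3)" for \<alpha> \<beta> c1 c2 D x c3 :: complex
          by (simp add: add_divide_distrib diff_divide_distrib algebra_simps)
        show "(Psi_sh (v s) k - Psi_sh (v t) k) / complex_of_real (s - t) - w k
            = 2 * antider q k + (if k = 0 then complex_of_real (?c s) else 0)"
          unfolding Psi_sh_def w_def z q_def alg by simp
      qed
      hence "hnorm (m + 1) (\<lambda>k. (Psi_sh (v s) k - Psi_sh (v t) k) / complex_of_real (s - t) - w k)
          \<le> hnorm (m + 1) (\<lambda>k. 2 * antider q k) + hnorm (m + 1) (\<lambda>k. if k = 0 then complex_of_real (?c s) else 0)"
        using antider_Hs[OF q] by (simp only:) (intro hnorm_add hfin_scale hfin_single, simp add: Hs_iff)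
      also have "\<dots> \<le> 2 * hnorm m q + \<bar>?c s\<bar>"
        unfolding hnorm_scale hnorm_single norm_of_real using hnorm_antider[OF q] by simp
      finally show ?case by (simp add: q_def)
    qed
    have "((\<lambda>s. 2 * ?r s + \<bar>?c s\<bar>) \<longlongrightarrow> 2 * 0 + \<bar>c' - c'\<bar>) (at t)"
      using d c' unfolding has_hderiv_def X_def has_field_derivative_iff by (intro tendsto_intros)
    thus "((\<lambda>s. 2 * ?r s + \<bar>?c s\<bar>) \<longlongrightarrow> 0) (at t)" by simp
  qed simp
  ultimately show "\<exists>w\<in>Hs (m + 1). has_hderiv (m + 1) (\<lambda>t. Psi_sh (v t)) w t \<and> dx w = sinh_seq (Psi_sh (v t))"
    using w by blast
qed

text \<open>Half of \<open>dx\<close> is bounded from order m + 1 to order m, with constant pi, and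
  recovers v from \<open>Psi_sh v\<close>. Applying it to the difference quotients of u gives those
  of v, and it sends w to \<open>X_sh (v t)\<close>.\<close>

lemma solves_SG_imp_solves_vsh:
  assumes vE: "\<And>t. t \<in> {a<..<b} \<Longrightarrow> v t \<in> Hs0 m" and u: "solves_SG m (\<lambda>t. Psi_sh (v t)) a b"
  shows "solves_vsh m v a b"
  unfolding solves_vsh_def
proof (intro ballI conjI)
  fix t assume t: "t \<in> {a<..<b}"
  show vt0: "v t \<in> Hs0 m" by (rule vE[OF t])
  hence vt: "v t \<in> Hs m" by (rule Hs0_Hs)
  obtain w where w: "w \<in> Hs (m + 1)" "has_hderiv (m + 1) (\<lambda>t. Psi_sh (v t)) w t" "dx w = sinh_seq (Psi_sh (v t))"
    using u t unfolding solves_SG_def by blast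
  have ev: "\<forall>\<^sub>F s in at t. v s \<in> Hs0 m"
    using t vE by (intro eventually_at_in_open'[of "{a<..<b}" t, THEN eventually_mono]) auto
  show "has_hderiv m v (X_sh (v t)) t"
    unfolding has_hderiv_def
  proof (rule tendsto_sandwich[OF always_eventually _ tendsto_const])
    let ?r = "\<lambda>s. hnorm (m + 1) (\<lambda>k. (Psi_sh (v s) k - Psi_sh (v t) k) / complex_of_real (s - t) - w k)"
    show "\<forall>\<^sub>F s in at t. hnorm m (\<lambda>k. (v s k - v t k) / complex_of_real (s - t) - X_sh (v t) k) \<le> pi * ?r s"
      using ev
    proof eventually_elim
      case (elim s)
      define q where "q = (\<lambda>k. (Psi_sh (v s) k - Psi_sh (v t) k) / complex_of_real (s - t) - w k)"
      have "hfin (m + 1) (\<lambda>k. complex_of_real (1 / (s - t)) * (Psi_sh (v s) k - Psi_sh (v t) k) - w k)"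
        using Psi_sh_Hs[OF Hs0_Hs[OF elim]] Psi_sh_Hs[OF vt] w(1)
        by (intro hfin_diff hfin_scale) (auto simp: Hs_iff)
      hence q: "hfin (m + 1) q" by (simp add: q_def)
      have "(v s k - v t k) / complex_of_real (s - t) - X_sh (v t) k = (1 / 2) * dx q k" for k
      proof -
        have "dx q k = (dx (Psi_sh (v s)) k - dx (Psi_sh (v t)) k) / complex_of_real (s - t) - dx w k"
          by (simp add: dx_def q_def algebra_simps diff_divide_distrib)
        also have "\<dots> = (2 * v s k - 2 * v t k) / complex_of_real (s - t) - 2 * X_sh (v t) k"
          using dx_Psi_sh[of "v s" k] dx_Psi_sh[of "v t" k] elim vt0 w(3) sinh_seq_Psi_sh[OF vt, of k]
          by (simp add: Hs0_def field_simps)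
        finally show ?thesis by (simp add: field_simps)
      qed
      hence "hnorm m (\<lambda>k. (v s k - v t k) / complex_of_real (s - t) - X_sh (v t) k) = 1 / 2 * hnorm m (dx q)"
        by (simp only: hnorm_scale) simp
      also have "\<dots> \<le> pi * hnorm (m + 1) q" using hnorm_dx[OF q] by simp
      finally show ?case by (simp add: q_def)
    qed
    have "((\<lambda>s. pi * ?r s) \<longlongrightarrow> pi * 0) (at t)"
      using w(2) unfolding has_hderiv_def by (intro tendsto_intros)
    thus "((\<lambda>s. pi * ?r s) \<longlongrightarrow> 0) (at t)" by simp
  qed simp
qed

subsection \<open>The logarithm of a power series\<close>

text \<open>For the series \<phi> with coefficients \<alpha> and \<Lambda> with coefficients d n /
  n, the recursion says that \<phi>' = \<phi> \<Lambda>'. The claim is that \<phi> = exp \<Lambda>,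
  evaluated at 1.\<close>

lemma ln_power_series:
  fixes \<alpha> d :: "nat \<Rightarrow> real"
  assumes \<alpha>0: "\<alpha> 0 = 1" and \<alpha>: "\<And>n. \<bar>\<alpha> n\<bar> \<le> \<sigma> ^ n" and d: "\<And>n. \<bar>d n\<bar> \<le> \<sigma> ^ n"
    and \<sigma>: "0 \<le> \<sigma>" "\<sigma> \<le> 1 / 2"
    and rec: "\<And>n. d n = real n * \<alpha> n - (\<Sum>k\<in>{1..<n}. d k * \<alpha> (n - k))"
  shows "(\<lambda>n. d n / real n) sums ln (\<Sum>n. \<alpha> n)"
proof -
  \<comment> \<open>At n = 0 the quotient is 0 because division by 0 yields 0, so \<Lambda> has no
    constant term.\<close>
  define L where "L n = d n / real n" for n
  \<comment> \<open>Any radius between 1 and 2 serves: the interval from 0 to 1 must lie strictly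
    inside, and \<sigma> times the radius must stay below 1 for \<sigma> up to 1 / 2.\<close>
  define K :: real where "K = 3 / 2"
  have L: "\<bar>L n\<bar> \<le> \<sigma> ^ n" for n
  proof (cases "n = 0")
    case False
    hence "\<bar>d n\<bar> / real n \<le> \<bar>d n\<bar>" by (simp add: divide_le_eq mult_le_cancel_left1)
    with d[of n] show ?thesis by (simp add: L_def)
  qed (simp add: L_def)
  have sm: "summable (\<lambda>n. norm (c n * x ^ n))" if "\<And>n. \<bar>c n\<bar> \<le> C * \<sigma> ^ n" "\<bar>x\<bar> \<le> K" for c :: "nat \<Rightarrow> real" and C x
  proof (rule summable_comparison_test')
    have "\<sigma> * K \<le> 1 / 2 * K" using \<sigma> by (intro mult_right_mono) (auto simp: K_def)
    hence "norm (\<sigma> * K) < 1" using \<sigma> by (simp add: K_def)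
    thus "summable (\<lambda>n. C * (\<sigma> * K) ^ n)" by (intro summable_mult summable_geometric)
    fix n
    have "\<bar>c n\<bar> * \<bar>x\<bar> ^ n \<le> (C * \<sigma> ^ n) * K ^ n"
      using that(1)[of n] that(2) by (intro mult_mono power_mono) auto
    thus "norm (norm (c n * x ^ n)) \<le> C * (\<sigma> * K) ^ n"
      by (simp add: abs_mult power_abs power_mult_distrib mult.assoc)
  qed
  define \<phi> \<Lambda> where "\<phi> x = (\<Sum>n. \<alpha> n * x ^ n)" and "\<Lambda> x = (\<Sum>n. L n * x ^ n)" for x
  have D\<phi>: "(\<phi> has_real_derivative (\<Sum>n. diffs \<alpha> n * x ^ n)) (at x)" if "\<bar>x\<bar> < K" for x
    unfolding \<phi>_def[abs_def] using that sm[of \<alpha> 1 K] \<alpha>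
    by (intro termdiffs_strong[of _ K]) (auto simp: K_def intro: summable_norm_cancel)
  have D\<Lambda>: "(\<Lambda> has_real_derivative (\<Sum>n. diffs L n * x ^ n)) (at x)" if "\<bar>x\<bar> < K" for x
    unfolding \<Lambda>_def[abs_def] using that sm[of L 1 K] L
    by (intro termdiffs_strong[of _ K]) (auto simp: K_def intro: summable_norm_cancel)
  have dL: "diffs L n = d (Suc n)" for n by (simp add: diffs_def L_def)
  \<comment> \<open>The left side is the n-th coefficient of \<Lambda>' \<phi>. Its last summand,
    where \<open>\<alpha> 0 = 1\<close>, is the term d (Suc n) on the left of the recursion.\<close>
  have conv: "(\<Sum>i\<le>n. d (Suc i) * \<alpha> (n - i)) = diffs \<alpha> n" for n
  proof -
    have "(\<Sum>i\<le>n. d (Suc i) * \<alpha> (n - i)) = (\<Sum>i<n. d (Suc i) * \<alpha> (n - i)) + d (Suc n)"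
      using \<alpha>0 by (simp add: lessThan_Suc_atMost[symmetric])
    also have "(\<Sum>i<n. d (Suc i) * \<alpha> (n - i)) = (\<Sum>k\<in>{1..<Suc n}. d k * \<alpha> (Suc n - k))"
      by (rule sum.reindex_bij_witness[of _ "\<lambda>k. k - 1" Suc]) auto
    finally show ?thesis using rec[of "Suc n"] by (simp add: diffs_def)
  qed
  have prod: "(\<Sum>n. diffs L n * x ^ n) * \<phi> x = (\<Sum>n. diffs \<alpha> n * x ^ n)" if "\<bar>x\<bar> < K" for x
  proof -
    have "\<bar>diffs L n\<bar> \<le> \<sigma> * \<sigma> ^ n" for n using d[of "Suc n"] by (simp add: dL)
    hence "summable (\<lambda>n. norm (diffs L n * x ^ n))" using that by (intro sm[of _ \<sigma>]) auto
    moreover have "summable (\<lambda>n. norm (\<alpha> n * x ^ n))" using that \<alpha> by (intro sm[of _ 1]) auto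
    ultimately have "(\<Sum>n. diffs L n * x ^ n) * \<phi> x
        = (\<Sum>n. \<Sum>i\<le>n. (diffs L i * x ^ i) * (\<alpha> (n - i) * x ^ (n - i)))"
      unfolding \<phi>_def by (rule Cauchy_product)
    also have "\<dots> = (\<Sum>n. (\<Sum>i\<le>n. d (Suc i) * \<alpha> (n - i)) * x ^ n)"
    proof (intro suminf_cong)
      fix n
      have *: "(diffs L i * x ^ i) * (\<alpha> (n - i) * x ^ (n - i)) = d (Suc i) * \<alpha> (n - i) * x ^ n" if "i \<le> n" for i
        using that power_add[of x i "n - i"] by (simp add: dL)
      show "(\<Sum>i\<le>n. (diffs L i * x ^ i) * (\<alpha> (n - i) * x ^ (n - i))) = (\<Sum>i\<le>n. d (Suc i) * \<alpha> (n - i)) * x ^ n"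
        unfolding sum_distrib_right by (rule sum.cong[OF refl]) (rule *, simp)
    qed
    finally show ?thesis by (simp add: conv)
  qed
  \<comment> \<open>Working with \<phi> exp (- \<Lambda>) in place of ln \<phi> means that
    positivity of \<phi> is a result and not a prerequisite.\<close>
  have "\<exists>c. \<forall>x\<in>{0..1}. \<phi> x * exp (- \<Lambda> x) = c"
  proof (rule has_field_derivative_zero_constant)
    fix x :: real assume "x \<in> {0..1}"
    hence x: "\<bar>x\<bar> < K" by (auto simp: K_def)
    have "((\<lambda>x. \<phi> x * exp (- \<Lambda> x)) has_real_derivative
        (\<Sum>n. diffs \<alpha> n * x ^ n) * exp (- \<Lambda> x) + - (\<Sum>n. diffs L n * x ^ n) * exp (- \<Lambda> x) * \<phi> x) (at x)"
      by (rule derivative_eq_intros D\<phi>[OF x] D\<Lambda>[OF x] refl)+ simp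
    moreover have "(\<Sum>n. diffs \<alpha> n * x ^ n) * exp (- \<Lambda> x) + - (\<Sum>n. diffs L n * x ^ n) * exp (- \<Lambda> x) * \<phi> x = 0"
      unfolding prod[OF x, symmetric] by (simp add: algebra_simps)
    ultimately show "((\<lambda>x. \<phi> x * exp (- \<Lambda> x)) has_real_derivative 0) (at x within {0..1})"
      by (metis has_field_derivative_at_within)
  qed simp
  then obtain c where c: "\<And>x. x \<in> {0..1} \<Longrightarrow> \<phi> x * exp (- \<Lambda> x) = c" by blast
  have "L 0 = 0" by (simp add: L_def)
  hence "\<phi> 0 = 1" "\<Lambda> 0 = 0" by (simp_all add: \<phi>_def \<Lambda>_def \<alpha>0)
  with c[of 0] c[of 1] have "\<phi> 1 * exp (- \<Lambda> 1) = 1" by simp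
  hence "\<phi> 1 = exp (\<Lambda> 1)" by (simp add: exp_minus field_simps)
  hence "\<Lambda> 1 = ln (\<Sum>n. \<alpha> n)" by (simp add: \<phi>_def)
  moreover have "summable L"
    using sm[of L 1 1] L by (auto simp: K_def intro: summable_norm_cancel)
  ultimately show ?thesis
    using summable_sums[of L] by (simp add: \<Lambda>_def L_def[abs_def])
qed

subsection \<open>Bounded multilinear forms\<close>

text \<open>The real-valued counterpart of \<open>mlin_bounded\<close>. A j-linear form is a
  functional on infinite tuples; the last clause says that it reads only the first j entries, which
  lets products be formed by shifting indices.\<close>

definition mform :: "fseq set \<Rightarrow> nat \<Rightarrow> nat \<Rightarrow> ((nat \<Rightarrow> fseq) \<Rightarrow> real) \<Rightarrow> real \<Rightarrow> bool" where
  "mform E m j A C \<longleftrightarrow>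
     (\<forall>hs. (\<forall>i<j. hs i \<in> E) \<longrightarrow> \<bar>A hs\<bar> \<le> C * (\<Prod>i<j. hnorm m (hs i))) \<and>
     (\<forall>hs i x y a b. (\<forall>l<j. hs l \<in> E) \<longrightarrow> i < j \<longrightarrow> x \<in> E \<longrightarrow> y \<in> E \<longrightarrow>
         A (hs(i := sadd (sscale a x) (sscale b y))) = a * A (hs(i := x)) + b * A (hs(i := y))) \<and>
     (\<forall>hs hs'. (\<forall>i<j. hs i = hs' i) \<longrightarrow> A hs = A hs')"

lemma
  assumes "mform E m j A C"
  shows mform_bound: "\<And>hs. (\<And>i. i < j \<Longrightarrow> hs i \<in> E) \<Longrightarrow> \<bar>A hs\<bar> \<le> C * (\<Prod>i<j. hnorm m (hs i))"
    and mform_linear: "\<And>hs i x y a b. (\<And>l. l < j \<Longrightarrow> hs l \<in> E) \<Longrightarrow> i < j \<Longrightarrow> x \<in> E \<Longrightarrow> y \<in> E \<Longrightarrow>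
         A (hs(i := sadd (sscale a x) (sscale b y))) = a * A (hs(i := x)) + b * A (hs(i := y))"
    and mform_cong: "\<And>hs hs'. (\<And>i. i < j \<Longrightarrow> hs i = hs' i) \<Longrightarrow> A hs = A hs'"
  using assms unfolding mform_def by blast+

lemma mformI:
  assumes "\<And>hs. (\<And>i. i < j \<Longrightarrow> hs i \<in> E) \<Longrightarrow> \<bar>A hs\<bar> \<le> C * (\<Prod>i<j. hnorm m (hs i))"
    and "\<And>hs i x y a b. (\<And>l. l < j \<Longrightarrow> hs l \<in> E) \<Longrightarrow> i < j \<Longrightarrow> x \<in> E \<Longrightarrow> y \<in> E \<Longrightarrow>
         A (hs(i := sadd (sscale a x) (sscale b y))) = a * A (hs(i := x)) + b * A (hs(i := y))"
    and "\<And>hs hs'. (\<And>i. i < j \<Longrightarrow> hs i = hs' i) \<Longrightarrow> A hs = A hs'"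
  shows "mform E m j A C"
  unfolding mform_def using assms by blast

lemma mform_mono:
  assumes "mform E m j A C" "C \<le> C'"
  shows "mform E m j A C'"
proof (rule mformI)
  fix hs assume h: "\<And>i. i < j \<Longrightarrow> hs i \<in> E"
  have "\<bar>A hs\<bar> \<le> C * (\<Prod>i<j. hnorm m (hs i))" by (rule mform_bound[OF assms(1)]) (rule h)
  also have "\<dots> \<le> C' * (\<Prod>i<j. hnorm m (hs i))"
    by (intro mult_right_mono assms(2) prod_nonneg) auto
  finally show "\<bar>A hs\<bar> \<le> C' * (\<Prod>i<j. hnorm m (hs i))" .
qed (use mform_linear[OF assms(1)] mform_cong[OF assms(1)] in blast)+

lemma mform_zero: "mform E m j (\<lambda>_. 0) 0"
  by (rule mformI) auto

lemma mform_lincomb: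
  assumes A: "mform E m j A C" and B: "mform E m j B D"
  shows "mform E m j (\<lambda>hs. \<alpha> * A hs + \<beta> * B hs) (\<bar>\<alpha>\<bar> * C + \<bar>\<beta>\<bar> * D)"
proof (rule mformI)
  fix hs assume h: "\<And>i. i < j \<Longrightarrow> hs i \<in> E"
  have "\<bar>\<alpha> * A hs + \<beta> * B hs\<bar> \<le> \<bar>\<alpha>\<bar> * \<bar>A hs\<bar> + \<bar>\<beta>\<bar> * \<bar>B hs\<bar>"
    by (metis abs_mult abs_triangle_ineq)
  also have "\<dots> \<le> \<bar>\<alpha>\<bar> * (C * (\<Prod>i<j. hnorm m (hs i))) + \<bar>\<beta>\<bar> * (D * (\<Prod>i<j. hnorm m (hs i)))"
    by (intro add_mono mult_left_mono mform_bound[OF A h] mform_bound[OF B h]) auto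
  finally show "\<bar>\<alpha> * A hs + \<beta> * B hs\<bar> \<le> (\<bar>\<alpha>\<bar> * C + \<bar>\<beta>\<bar> * D) * (\<Prod>i<j. hnorm m (hs i))"
    by (simp add: algebra_simps)
next
  fix hs i x y a b assume h: "\<And>l. l < j \<Longrightarrow> hs l \<in> E" "i < j" "x \<in> E" "y \<in> E"
  have "A (hs(i := sadd (sscale a x) (sscale b y))) = a * A (hs(i := x)) + b * A (hs(i := y))"
    by (rule mform_linear[OF A]) (use h in auto)
  moreover have "B (hs(i := sadd (sscale a x) (sscale b y))) = a * B (hs(i := x)) + b * B (hs(i := y))"
    by (rule mform_linear[OF B]) (use h in auto)
  ultimately show "\<alpha> * A (hs(i := sadd (sscale a x) (sscale b y))) + \<beta> * B (hs(i := sadd (sscale a x) (sscale b y))) =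
       a * (\<alpha> * A (hs(i := x)) + \<beta> * B (hs(i := x))) + b * (\<alpha> * A (hs(i := y)) + \<beta> * B (hs(i := y)))"
    by (simp add: algebra_simps)
next
  fix hs hs' :: "nat \<Rightarrow> fseq" assume "\<And>i. i < j \<Longrightarrow> hs i = hs' i"
  from mform_cong[OF A this] mform_cong[OF B this]
  show "\<alpha> * A hs + \<beta> * B hs = \<alpha> * A hs' + \<beta> * B hs'" by simp
qed

lemma mform_sum:
  assumes "finite S" "\<And>k. k \<in> S \<Longrightarrow> mform E m j (A k) (C k)"
  shows "mform E m j (\<lambda>hs. \<Sum>k\<in>S. A k hs) (\<Sum>k\<in>S. C k)"
  using assms
proof (induction S)
  case (insert k S)
  have "mform E m j (\<lambda>hs. 1 * A k hs + 1 * (\<Sum>k\<in>S. A k hs)) (\<bar>1\<bar> * C k + \<bar>1\<bar> * (\<Sum>k\<in>S. C k))"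
    by (intro mform_lincomb insert) auto
  with insert(1,2) show ?case by simp
qed (simp add: mform_zero)

text \<open>The tensor product: \<open>A\<close> reads the first j arguments and \<open>B\<close>
  the next l. No symmetrization is made, since \<open>analytic_at\<close> evaluates the forms on the
  diagonal only.\<close>

lemma mform_mult:
  assumes A: "mform E m j A C" and B: "mform E m l B D"
  shows "mform E m (j + l) (\<lambda>hs. A hs * B (\<lambda>i. hs (i + j))) (C * D)"
proof (rule mformI)
  fix hs assume h: "\<And>i. i < j + l \<Longrightarrow> hs i \<in> E"
  have a: "\<bar>A hs\<bar> \<le> C * (\<Prod>i<j. hnorm m (hs i))" using h by (intro mform_bound[OF A]) auto
  have b: "\<bar>B (\<lambda>i. hs (i + j))\<bar> \<le> D * (\<Prod>i<l. hnorm m (hs (i + j)))" using h by (intro mform_bound[OF B]) auto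
  have "\<bar>A hs * B (\<lambda>i. hs (i + j))\<bar> \<le> (C * (\<Prod>i<j. hnorm m (hs i))) * (D * (\<Prod>i<l. hnorm m (hs (i + j))))"
    unfolding abs_mult using a b by (intro mult_mono) (auto intro: order_trans[OF abs_ge_zero])
  moreover have "(\<Prod>i<j. hnorm m (hs i)) * (\<Prod>i<l. hnorm m (hs (i + j))) = (\<Prod>i<j + l. hnorm m (hs i))"
    by (induction l) (auto simp: mult.assoc[symmetric] add.commute)
  ultimately show "\<bar>A hs * B (\<lambda>i. hs (i + j))\<bar> \<le> C * D * (\<Prod>i<j + l. hnorm m (hs i))"
    by (metis mult.assoc mult.left_commute)
next
  fix hs i x y a b assume h: "\<And>i. i < j + l \<Longrightarrow> hs i \<in> E" "i < j + l" "x \<in> E" "y \<in> E"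
  show "A (hs(i := sadd (sscale a x) (sscale b y))) * B (\<lambda>n. (hs(i := sadd (sscale a x) (sscale b y))) (n + j)) =
       a * (A (hs(i := x)) * B (\<lambda>n. (hs(i := x)) (n + j))) + b * (A (hs(i := y)) * B (\<lambda>n. (hs(i := y)) (n + j)))"
  proof (cases "i < j")
    case True
    have s: "(\<lambda>n. (hs(i := z)) (n + j)) = (\<lambda>n. hs (n + j))" for z using True by auto
    have "A (hs(i := sadd (sscale a x) (sscale b y))) = a * A (hs(i := x)) + b * A (hs(i := y))"
      using h True by (intro mform_linear[OF A]) auto
    thus ?thesis unfolding s by (simp add: algebra_simps)
  next
    case False
    have s: "(\<lambda>n. (hs(i := z)) (n + j)) = (\<lambda>n. hs (n + j))(i - j := z)" for z
      using False by (auto simp: fun_eq_iff)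
    have c: "A (hs(i := z)) = A hs" for z using False by (intro mform_cong[OF A]) auto
    have "B ((\<lambda>n. hs (n + j))(i - j := sadd (sscale a x) (sscale b y)))
        = a * B ((\<lambda>n. hs (n + j))(i - j := x)) + b * B ((\<lambda>n. hs (n + j))(i - j := y))"
      using h False by (intro mform_linear[OF B]) auto
    thus ?thesis unfolding s c by (simp add: algebra_simps)
  qed
next
  fix hs hs' :: "nat \<Rightarrow> fseq" assume h: "\<And>i. i < j + l \<Longrightarrow> hs i = hs' i"
  have "A hs = A hs'" using h by (intro mform_cong[OF A]) auto
  moreover have "B (\<lambda>i. hs (i + j)) = B (\<lambda>i. hs' (i + j))" using h by (intro mform_cong[OF B]) auto
  ultimately show "A hs * B (\<lambda>i. hs (i + j)) = A hs' * B (\<lambda>i. hs' (i + j))" by simp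
qed

text \<open>If g 0 = 1, this is n times the n-th Taylor form of the logarithm of the series G of the g n:
  compare coefficients in G' = G (ln G)'.\<close>

fun log_form :: "(nat \<Rightarrow> (nat \<Rightarrow> fseq) \<Rightarrow> real) \<Rightarrow> nat \<Rightarrow> (nat \<Rightarrow> fseq) \<Rightarrow> real" where
  "log_form g n hs = real n * g n hs - (\<Sum>k\<in>{1..<n}. log_form g k hs * g (n - k) (\<lambda>i. hs (i + k)))"

declare log_form.simps [simp del]

text \<open>Since n / n! and 1 / (n - k)! are at most 1, the recursion propagates the bound provided
  that 1 plus the sum of 3^k over 1 \<le> k < n stays below 3^n; this accounts for the factor
  3.\<close>

lemma mform_log_form:
  assumes g: "\<And>n. mform E m n (g n) (R ^ n / fact n)" and R: "R \<ge> 0"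
  shows "mform E m n (log_form g n) ((3 * R) ^ n)"
proof (induction n rule: less_induct)
  case (less n)
  define c where "c k = (3 * R) ^ k * (R ^ (n - k) / fact (n - k))" for k
  have "mform E m n (\<lambda>hs. \<Sum>k\<in>{1..<n}. log_form g k hs * g (n - k) (\<lambda>i. hs (i + k))) (\<Sum>k\<in>{1..<n}. c k)"
  proof (rule mform_sum)
    fix k assume k: "k \<in> {1..<n}"
    from mform_mult[OF less g[of "n - k"], of k] k
    show "mform E m n (\<lambda>hs. log_form g k hs * g (n - k) (\<lambda>i. hs (i + k))) (c k)"
      by (simp add: c_def)
  qed simp
  note lc = mform_lincomb[OF g this, of "real n" "-1"]
  have "(\<lambda>hs. real n * g n hs + - 1 * (\<Sum>k\<in>{1..<n}. log_form g k hs * g (n - k) (\<lambda>i. hs (i + k)))) = log_form g n"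
    by (rule ext) (subst log_form.simps[of g n], simp)
  with lc have "mform E m n (log_form g n) (\<bar>real n\<bar> * (R ^ n / fact n) + \<bar>- 1\<bar> * (\<Sum>k\<in>{1..<n}. c k))"
    by (simp only:)
  hence "mform E m n (log_form g n) (real n * (R ^ n / fact n) + (\<Sum>k\<in>{1..<n}. c k))"
    by simp
  moreover have "real n * (R ^ n / fact n) + (\<Sum>k\<in>{1..<n}. c k) \<le> (3 * R) ^ n"
  proof (cases "n = 0")
    case False
    have "real n \<le> fact n" using fact_ge_self[of n] by (metis of_nat_fact of_nat_le_iff)
    hence 1: "real n * (R ^ n / fact n) \<le> R ^ n"
      using mult_right_mono[of "real n" "fact n" "R ^ n"] R by (simp add: field_simps)
    have "c k \<le> 3 ^ k * R ^ n" if "k \<in> {1..<n}" for k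
    proof -
      have "c k \<le> (3 * R) ^ k * R ^ (n - k)"
        unfolding c_def using R by (intro mult_left_mono) (auto simp: divide_le_eq mult_le_cancel_left1)
      also have "\<dots> = 3 ^ k * (R ^ k * R ^ (n - k))" by (simp add: power_mult_distrib)
      also have "R ^ k * R ^ (n - k) = R ^ n" using that by (simp flip: power_add)
      finally show ?thesis .
    qed
    hence "(\<Sum>k\<in>{1..<n}. c k) \<le> (\<Sum>k\<in>{1..<n}. 3 ^ k * R ^ n)" by (rule sum_mono)
    also have "\<dots> = (\<Sum>k\<in>{1..<n}. 3 ^ k) * R ^ n" by (simp add: sum_distrib_right)
    finally have 2: "(\<Sum>k\<in>{1..<n}. c k) \<le> (\<Sum>k\<in>{1..<n}. 3 ^ k) * R ^ n" .
    have "1 + (\<Sum>k\<in>{1..<Suc l}. 3 ^ k) \<le> (3::real) ^ Suc l" for l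
    proof (induction l)
      case (Suc l)
      have "(\<Sum>k\<in>{1..<Suc (Suc l)}. (3::real) ^ k) = (\<Sum>k\<in>{1..<Suc l}. 3 ^ k) + 3 ^ Suc l"
        by (subst sum.op_ivl_Suc) (simp del: power_Suc)
      moreover have "(3::real) ^ Suc (Suc l) = 3 * 3 ^ Suc l" "(3::real) ^ Suc l \<ge> 0" by simp_all
      ultimately show ?case using Suc by linarith
    qed simp
    from this[of "n - 1"] False have "1 + (\<Sum>k\<in>{1..<n}. 3 ^ k) \<le> (3::real) ^ n" by simp
    from mult_right_mono[OF this, of "R ^ n"] R 1 2
    show ?thesis by (simp add: power_mult_distrib algebra_simps)
  qed simp
  ultimately show ?case by (rule mform_mono)
qed

text \<open>The n-th Taylor form of \<open>expint a\<close> at v, normalized by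
  \<open>expint a v\<close> so that the form of degree 0 is 1, as \<open>log_form\<close>
  requires.\<close>

definition exp_form :: "real \<Rightarrow> fseq \<Rightarrow> nat \<Rightarrow> (nat \<Rightarrow> fseq) \<Rightarrow> real" where
  "exp_form a v n hs = a ^ n / fact n
     * (intT (\<lambda>x. exp (a * fseries (antider v) x) * (\<Prod>i<n. fseries (antider (hs i)) x)) / expint a v)"

text \<open>The weight exp (a w) / \<open>expint a v\<close> is a probability density, so the form
  is bounded by the sup norms of its arguments, each at most \<open>embed_const\<close> times a
  Sobolev norm.\<close>

lemma mform_exp_form:
  assumes v: "v \<in> Hs m"
  shows "mform (Hs m) m n (exp_form a v n) ((\<bar>a\<bar> * embed_const) ^ n / fact n)"
proof (rule mformI)
  have Z: "expint a v > 0" by (rule expint_pos[OF v])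
  {
  fix hs :: "nat \<Rightarrow> fseq" assume h: "\<And>i. i < n \<Longrightarrow> hs i \<in> Hs m"
  have cont: "continuous_on {0..1} (\<lambda>x. \<Prod>i<n. fseries (antider (hs i)) x)"
    by (intro continuous_on_prod continuous_on_fseries_antider) (auto intro: h)
  define I where "I = intT (\<lambda>x. exp (a * fseries (antider v) x) * (\<Prod>i<n. fseries (antider (hs i)) x))"
  have "\<bar>\<Prod>i<n. fseries (antider (hs i)) x\<bar> \<le> (\<Prod>i<n. embed_const * hnorm m (hs i))" for x
    unfolding abs_prod by (intro prod_mono conjI abs_fseries_antider_le) (auto intro: h)
  hence "\<bar>I\<bar> \<le> (\<Prod>i<n. embed_const * hnorm m (hs i)) * expint a v"
    unfolding I_def expint_def
    by (intro abs_intT_mult_le cont continuous_intros continuous_on_fseries_antider[OF v]) auto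
  hence "\<bar>I / expint a v\<bar> \<le> (\<Prod>i<n. embed_const * hnorm m (hs i))"
    using Z by (simp add: field_simps)
  also have "\<dots> = embed_const ^ n * (\<Prod>i<n. hnorm m (hs i))" by (simp add: prod.distrib)
  finally have "\<bar>a ^ n / fact n\<bar> * \<bar>I / expint a v\<bar> \<le> \<bar>a ^ n / fact n\<bar> * (embed_const ^ n * (\<Prod>i<n. hnorm m (hs i)))"
    by (intro mult_left_mono) auto
  thus "\<bar>exp_form a v n hs\<bar> \<le> (\<bar>a\<bar> * embed_const) ^ n / fact n * (\<Prod>i<n. hnorm m (hs i))"
    unfolding exp_form_def I_def[symmetric] abs_mult by (simp add: power_abs power_mult_distrib)
  }
  fix hs i x y b c assume h: "\<And>l. l < n \<Longrightarrow> hs l \<in> Hs m" "i < n" "x \<in> Hs m" "y \<in> Hs m"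
  \<comment> \<open>All factors except the one in slot i are collected here, so that the integrand
    is visibly linear in that slot.\<close>
  define f where "f t = exp (a * fseries (antider v) t) * (\<Prod>l\<in>{..<n} - {i}. fseries (antider (hs l)) t)" for t
  have cf: "continuous_on {0..1} f" unfolding f_def
    by (intro continuous_intros continuous_on_prod continuous_on_fseries_antider[OF v]
        continuous_on_fseries_antider[OF h(1)]) auto
  have e: "exp (a * fseries (antider v) t) * (\<Prod>l<n. fseries (antider ((hs(i := z)) l)) t) = f t * fseries (antider z) t" for t z
  proof -
    have "(\<Prod>l<n. fseries (antider ((hs(i := z)) l)) t)
        = fseries (antider z) t * (\<Prod>l\<in>{..<n} - {i}. fseries (antider ((hs(i := z)) l)) t)"
      using h(2) by (subst prod.remove[of _ i]) auto
    also have "(\<Prod>l\<in>{..<n} - {i}. fseries (antider ((hs(i := z)) l)) t) = (\<Prod>l\<in>{..<n} - {i}. fseries (antider (hs l)) t)"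
      by (intro prod.cong) auto
    finally show ?thesis by (simp add: f_def)
  qed
  have i: "(\<lambda>t. f t * fseries (antider z) t) integrable_on {0..1}" if "z \<in> Hs m" for z
    by (intro integrable_continuous_interval continuous_intros cf continuous_on_fseries_antider[OF that])
  have "((\<lambda>t. b * (f t * fseries (antider x) t) + c * (f t * fseries (antider y) t)) has_integral
      (b * intT (\<lambda>t. f t * fseries (antider x) t) + c * intT (\<lambda>t. f t * fseries (antider y) t))) {0..1}"
    unfolding intT_def by (intro has_integral_add has_integral_mult_right integrable_integral i h)
  moreover have "fseries (antider (sadd (sscale b x) (sscale c y))) t
      = b * fseries (antider x) t + c * fseries (antider y) t" for t
    using fseries_antider_lincomb[OF h(3,4), of b c t] by (simp add: sadd_def sscale_def)
  ultimately have "intT (\<lambda>t. f t * fseries (antider (sadd (sscale b x) (sscale c y))) t)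
      = b * intT (\<lambda>t. f t * fseries (antider x) t) + c * intT (\<lambda>t. f t * fseries (antider y) t)"
    unfolding intT_def[of "\<lambda>t. f t * fseries (antider (sadd (sscale b x) (sscale c y))) t"]
    by (intro integral_unique) (simp add: algebra_simps)
  thus "exp_form a v n (hs(i := sadd (sscale b x) (sscale c y)))
      = b * exp_form a v n (hs(i := x)) + c * exp_form a v n (hs(i := y))"
    unfolding exp_form_def e by (simp add: add_divide_distrib algebra_simps)
next
  fix hs hs' :: "nat \<Rightarrow> fseq" assume "\<And>i. i < n \<Longrightarrow> hs i = hs' i"
  hence "(\<Prod>i<n. fseries (antider (hs i)) x) = (\<Prod>i<n. fseries (antider (hs' i)) x)" for x
    by (intro prod.cong) auto
  thus "exp_form a v n hs = exp_form a v n hs'" by (simp add: exp_form_def)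
qed

text \<open>The exponential series of a z converges uniformly because z is bounded; it is integrated
  term by term against exp (a w).\<close>

lemma exp_form_sums:
  assumes v: "v \<in> Hs m" and h: "h \<in> Hs m"
  shows "(\<lambda>n. exp_form a v n (\<lambda>_. h)) sums (expint a (sadd v h) / expint a v)"
proof -
  let ?w = "fseries (antider v)" and ?z = "fseries (antider h)"
  have cw: "continuous_on {0..1} (\<lambda>x. exp (a * ?w x))" and cz: "continuous_on {0..1} (\<lambda>x. a * ?z x)"
    by (intro continuous_intros continuous_on_fseries_antider[OF v] continuous_on_fseries_antider[OF h])+
  have "\<bar>a * ?z x\<bar> \<le> \<bar>a\<bar> * (embed_const * hnorm m h)" for x
    unfolding abs_mult by (intro mult_left_mono abs_fseries_antider_le[OF h]) auto
  note u = uniform_limit_exp_partial_sums[OF this, where A="{0..1}"]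
  have bd: "bounded ((\<lambda>x. exp (a * ?w x)) ` {0..1})" "bounded ((\<lambda>x. exp (a * ?z x)) ` {0..1})"
    using cw cz by (auto intro!: compact_imp_bounded compact_continuous_image continuous_intros)
  note u' = uniform_lim_mult[OF uniform_limit_const u bd]
  obtain I J where IJ:
    "\<And>N. ((\<lambda>x. exp (a * ?w x) * (\<Sum>n<N. (a * ?z x) ^ n / fact n)) has_integral I N) {0..1}"
    "((\<lambda>x. exp (a * ?w x) * exp (a * ?z x)) has_integral J) {0..1}" "I \<longlonglongrightarrow> J"
    by (rule uniform_limit_integral[OF u']) (use cw cz in \<open>auto intro!: continuous_intros\<close>)
  have J: "J = expint a (sadd v h)"
    using integral_unique[OF IJ(2)]
    by (simp add: expint_def intT_def fseries_antider_sadd[OF v h] exp_add distrib_left)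
  have I: "I N = expint a v * (\<Sum>n<N. exp_form a v n (\<lambda>_. h))" for N
  proof -
    have Z: "expint a v > 0" by (rule expint_pos[OF v])
    have "((\<lambda>x. \<Sum>n<N. a ^ n / fact n * (exp (a * ?w x) * ?z x ^ n)) has_integral
        (\<Sum>n<N. a ^ n / fact n * intT (\<lambda>x. exp (a * ?w x) * ?z x ^ n))) {0..1}"
      unfolding intT_def
      by (intro has_integral_sum has_integral_mult_right integrable_integral integrable_continuous_interval
          continuous_intros cw continuous_on_fseries_antider[OF h]) auto
    moreover have "(\<Sum>n<N. a ^ n / fact n * (exp (a * ?w x) * ?z x ^ n)) = exp (a * ?w x) * (\<Sum>n<N. (a * ?z x) ^ n / fact n)" for x
      by (simp add: sum_distrib_left power_mult_distrib mult_ac)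
    ultimately have "((\<lambda>x. exp (a * ?w x) * (\<Sum>n<N. (a * ?z x) ^ n / fact n)) has_integral
        (\<Sum>n<N. a ^ n / fact n * intT (\<lambda>x. exp (a * ?w x) * ?z x ^ n))) {0..1}"
      by (simp only:)
    from has_integral_unique[OF IJ(1)[of N] this]
    have "I N = (\<Sum>n<N. a ^ n / fact n * intT (\<lambda>x. exp (a * ?w x) * ?z x ^ n))" .
    also have "\<dots> = (\<Sum>n<N. expint a v * exp_form a v n (\<lambda>_. h))"
      using Z by (intro sum.cong) (auto simp: exp_form_def)
    finally show ?thesis by (simp add: sum_distrib_left)
  qed
  have Z: "expint a v > 0" by (rule expint_pos[OF v])
  have "(\<lambda>N. I N / expint a v) \<longlonglongrightarrow> J / expint a v" by (intro tendsto_intros IJ) (use Z in simp)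
  thus ?thesis using Z by (simp add: I J sums_def)
qed

lemma exp_form_0: "v \<in> Hs m \<Longrightarrow> exp_form a v 0 hs = 1"
  using expint_pos[of v m a] by (simp add: exp_form_def expint_def)

subsection \<open>Analyticity\<close>

text \<open>A scalar is encoded as a zero mode. Its weight is 1 in every order, so the target order
  n is arbitrary and the constant is unchanged.\<close>

lemma mlin_bounded_mform:
  assumes "mform E m j A C"
  shows "mlin_bounded E m n j (\<lambda>hs k. if k = 0 then complex_of_real (A hs) else 0) C"
  unfolding mlin_bounded_def
proof (intro conjI allI impI)
  fix hs assume h: "\<forall>i<j. hs i \<in> E"
  show "(\<lambda>k. if k = 0 then complex_of_real (A hs) else 0) \<in> Hs n" by (rule Hs_const)
  show "hnorm n (\<lambda>k. if k = 0 then complex_of_real (A hs) else 0) \<le> C * (\<Prod>i<j. hnorm m (hs i))"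
    using mform_bound[OF assms] h by (simp add: hnorm_single)
next
  fix hs i x y a b assume h: "\<forall>l<j. hs l \<in> E" "i < j" "x \<in> E" "y \<in> E"
  have "A (hs(i := sadd (sscale a x) (sscale b y))) = a * A (hs(i := x)) + b * A (hs(i := y))"
    using h by (intro mform_linear[OF assms]) auto
  thus "(\<lambda>k. if k = 0 then complex_of_real (A (hs(i := sadd (sscale a x) (sscale b y)))) else 0) =
       sadd (sscale a (\<lambda>k. if k = 0 then complex_of_real (A (hs(i := x))) else 0))
        (sscale b (\<lambda>k. if k = 0 then complex_of_real (A (hs(i := y))) else 0))"
    by (auto simp: sadd_def sscale_def)
next
  fix hs hs' :: "nat \<Rightarrow> fseq" assume "\<forall>i<j. hs i = hs' i"
  hence "A hs = A hs'" by (intro mform_cong[OF assms]) auto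
  thus "(\<lambda>k. if k = 0 then complex_of_real (A hs) else 0) = (\<lambda>k. if k = 0 then complex_of_real (A hs') else 0)"
    by (simp add: fun_eq_iff)
qed

text \<open>The increment of ln \<open>expint a\<close> is the logarithm of the quotient of the
  values at v + h and v, whose Taylor forms are \<open>exp_form a v\<close>. As
  \<open>log_form\<close> carries an additional factor j, it is divided by j in
  \<open>A\<close>.\<close>

lemma analytic_at_ln_expint:
  assumes v: "v \<in> Hs m"
  shows "analytic_at (Hs m) m n (\<lambda>v k. if k = 0 then complex_of_real (ln (expint a v)) else 0) v"
proof -
  define R where "R = \<bar>a\<bar> * embed_const"
  have R: "R \<ge> 0" by (simp add: R_def embed_const_nonneg)
  define g where "g = exp_form a v"
  have g: "mform (Hs m) m n (g n) (R ^ n / fact n)" for n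
    unfolding g_def R_def by (rule mform_exp_form[OF v])
  note D = mform_log_form[OF g R]
  define A where "A j hs = (if j = 0 then ln (expint a v) else 1 / real j * log_form g j hs)" for j hs
  define C where "C j = (if j = 0 then \<bar>ln (expint a v)\<bar> else (3 * R) ^ j)" for j
  have A: "mform (Hs m) m j (A j) (C j)" for j
  proof (cases "j = 0")
    case True
    thus ?thesis by (intro mformI) (auto simp: A_def C_def)
  next
    case False
    have "1 / real j * (3 * R) ^ j \<le> 1 * (3 * R) ^ j"
      using False R by (intro mult_right_mono) (auto simp: divide_le_eq)
    moreover have "mform (Hs m) m j (A j) (1 / real j * (3 * R) ^ j)"
      using mform_lincomb[OF D[of j] mform_zero, of "1 / real j" 0] False by (simp add: A_def[abs_def])
    ultimately show ?thesis using False by (auto simp: C_def intro: mform_mono)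
  qed
  \<comment> \<open>The radius makes 3 R r at most 1 / 2, the range of
    \<open>ln_power_series\<close>; \<open>R + 1\<close> covers the case R = 0.\<close>
  define r where "r = 1 / (6 * (R + 1))"
  have r: "r > 0" and Rr: "3 * R * r \<le> 1 / 2"
    using R by (auto simp: r_def field_simps)
  show ?thesis
    unfolding analytic_at_def
  proof (intro exI conjI ballI impI allI)
    show "r > 0" by (rule r)
    show "mlin_bounded (Hs m) m n j (\<lambda>hs k. if k = 0 then complex_of_real (A j hs) else 0) (C j)" for j
      by (rule mlin_bounded_mform[OF A])
    have "summable (\<lambda>j. (3 * R * r) ^ j)" using Rr R r by (intro summable_geometric) auto
    \<comment> \<open>The constant \<open>C 0\<close> does not follow the geometric pattern, so
      summability is checked from index 1 on.\<close>
    hence "summable (\<lambda>j. (3 * R * r) ^ Suc j)" by (subst summable_Suc_iff)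
    moreover have "C (Suc j) * r ^ Suc j = (3 * R * r) ^ Suc j" for j
      unfolding C_def by (simp only: power_mult_distrib) simp
    ultimately have "summable (\<lambda>j. C (Suc j) * r ^ Suc j)" by (simp only:)
    thus "summable (\<lambda>j. C j * r ^ j)" by (subst (asm) summable_Suc_iff)
    fix h assume h: "h \<in> Hs m" and hr: "hnorm m h < r"
    define \<sigma> where "\<sigma> = 3 * R * hnorm m h"
    have "\<sigma> \<le> 3 * R * r" unfolding \<sigma>_def using hr R by (intro mult_left_mono) auto
    hence \<sigma>: "0 \<le> \<sigma>" "\<sigma> \<le> 1 / 2" using Rr R by (auto simp: \<sigma>_def)
    have "(\<lambda>j. log_form g j (\<lambda>_. h) / real j) sums ln (\<Sum>j. g j (\<lambda>_. h))"
    proof (rule ln_power_series[OF _ _ _ \<sigma>])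
      show "g 0 (\<lambda>_. h) = 1" unfolding g_def by (rule exp_form_0[OF v])
      fix j
      show "\<bar>log_form g j (\<lambda>_. h)\<bar> \<le> \<sigma> ^ j"
        using mform_bound[OF D, of j "\<lambda>_. h"] h by (simp add: \<sigma>_def power_mult_distrib)
      have "\<bar>g j (\<lambda>_. h)\<bar> \<le> R ^ j / fact j * hnorm m h ^ j"
        using mform_bound[OF g, of j "\<lambda>_. h"] h by simp
      also have "\<dots> \<le> (3 * R) ^ j * hnorm m h ^ j"
      proof (intro mult_right_mono)
        have "R ^ j / fact j \<le> R ^ j" using R by (simp add: divide_le_eq mult_le_cancel_left1)
        also have "\<dots> \<le> (3 * R) ^ j" using R by (intro power_mono) auto
        finally show "R ^ j / fact j \<le> (3 * R) ^ j" .
      qed simp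
      finally show "\<bar>g j (\<lambda>_. h)\<bar> \<le> \<sigma> ^ j" by (simp add: \<sigma>_def power_mult_distrib)
      show "log_form g j (\<lambda>_. h) = real j * g j (\<lambda>_. h)
          - (\<Sum>k\<in>{1..<j}. log_form g k (\<lambda>_. h) * g (j - k) (\<lambda>_. h))"
        by (subst log_form.simps[of g j]) simp
    qed
    also have "(\<Sum>j. g j (\<lambda>_. h)) = expint a (sadd v h) / expint a v"
      unfolding g_def using exp_form_sums[OF v h, of a] by (simp add: sums_iff)
    also have "ln \<dots> = ln (expint a (sadd v h)) - ln (expint a v)"
      using expint_pos[OF v, of a] expint_pos[OF sadd_Hs[OF v h], of a] by (simp add: ln_div)
    finally have s: "(\<lambda>j. log_form g j (\<lambda>_. h) / real j) sums (ln (expint a (sadd v h)) - ln (expint a v))" .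
    \<comment> \<open>The quotient of index 0 is 0; dropping it makes room for the constant form
      \<open>A 0\<close>.\<close>
    hence "(\<lambda>j. log_form g (Suc j) (\<lambda>_. h) / real (Suc j)) sums (ln (expint a (sadd v h)) - ln (expint a v))"
      by (subst sums_Suc_iff) simp
    hence "(\<lambda>j. A (Suc j) (\<lambda>_. h)) sums (ln (expint a (sadd v h)) - A 0 (\<lambda>_. h))"
      by (simp add: A_def)
    hence "(\<lambda>j. A j (\<lambda>_. h)) sums ln (expint a (sadd v h))" by (subst (asm) sums_Suc_iff) simp
    hence "(\<lambda>N. \<bar>ln (expint a (sadd v h)) - (\<Sum>j<N. A j (\<lambda>_. h))\<bar>)
        \<longlonglongrightarrow> \<bar>ln (expint a (sadd v h)) - ln (expint a (sadd v h))\<bar>"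
      unfolding sums_def by (intro tendsto_intros)
    moreover have "hnorm n (\<lambda>k. (if k = 0 then complex_of_real (ln (expint a (sadd v h))) else 0)
          - (\<Sum>j<N. if k = 0 then complex_of_real (A j (\<lambda>_. h)) else 0))
        = \<bar>ln (expint a (sadd v h)) - (\<Sum>j<N. A j (\<lambda>_. h))\<bar>" for N
    proof -
      have "(\<lambda>k. (if k = 0 then complex_of_real (ln (expint a (sadd v h))) else 0)
          - (\<Sum>j<N. if k = 0 then complex_of_real (A j (\<lambda>_. h)) else 0))
        = (\<lambda>k::int. if k = 0 then complex_of_real (ln (expint a (sadd v h)) - (\<Sum>j<N. A j (\<lambda>_. h))) else 0)"
        by auto
      thus ?thesis by (simp only: hnorm_single norm_of_real)
    qed
    ultimately show "(\<lambda>N. hnorm n (\<lambda>k. (if k = 0 then complex_of_real (ln (expint a (sadd v h))) else 0)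
          - (\<Sum>j<N. if k = 0 then complex_of_real (A j (\<lambda>_. h)) else 0))) \<longlonglongrightarrow> 0"
      by simp
  qed
qed

section \<open>Closure properties of analytic maps\<close>

lemma
  assumes "mlin_bounded E m n j A C"
  shows mlin_bounded_mem: "\<And>hs. \<forall>i<j. hs i \<in> E \<Longrightarrow> A hs \<in> Hs n"
    and mlin_bounded_bound: "\<And>hs. \<forall>i<j. hs i \<in> E \<Longrightarrow> hnorm n (A hs) \<le> C * (\<Prod>i<j. hnorm m (hs i))"
    and mlin_bounded_linear: "\<And>hs i x y a b. \<forall>l<j. hs l \<in> E \<Longrightarrow> i < j \<Longrightarrow> x \<in> E \<Longrightarrow> y \<in> E \<Longrightarrow>
         A (hs(i := sadd (sscale a x) (sscale b y))) = sadd (sscale a (A (hs(i := x)))) (sscale b (A (hs(i := y))))"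
    and mlin_bounded_cong: "\<And>hs hs'. \<forall>i<j. hs i = hs' i \<Longrightarrow> A hs = A hs'"
  using assms unfolding mlin_bounded_def by blast+

lemma analytic_at_subset:
  assumes "analytic_at E m n F p" "E' \<subseteq> E"
  shows "analytic_at E' m n F p"
proof -
  obtain r A C where r: "r > 0" and A: "\<And>j. mlin_bounded E m n j (A j) (C j)"
    and C: "summable (\<lambda>j. C j * r ^ j)"
    and F: "\<And>h. h \<in> E \<Longrightarrow> hnorm m h < r \<Longrightarrow>
      (\<lambda>N. hnorm n (\<lambda>k. F (sadd p h) k - (\<Sum>j<N. A j (\<lambda>_. h) k))) \<longlonglongrightarrow> 0"
    using assms(1) unfolding analytic_at_def by blast
  have A': "mlin_bounded E' m n j (A j) (C j)" for j
    unfolding mlin_bounded_def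
  proof (intro conjI allI impI)
    fix hs assume h: "\<forall>i<j. hs i \<in> E'"
    hence h': "\<forall>i<j. hs i \<in> E" using assms(2) by blast
    show "A j hs \<in> Hs n" by (rule mlin_bounded_mem[OF A h'])
    show "hnorm n (A j hs) \<le> C j * (\<Prod>i<j. hnorm m (hs i))" by (rule mlin_bounded_bound[OF A h'])
    fix i x y a b assume "i < j" "x \<in> E'" "y \<in> E'"
    with assms(2) show "A j (hs(i := sadd (sscale a x) (sscale b y)))
        = sadd (sscale a (A j (hs(i := x)))) (sscale b (A j (hs(i := y))))"
      by (intro mlin_bounded_linear[OF A h']) auto
  qed (rule mlin_bounded_cong[OF A])
  show ?thesis
    unfolding analytic_at_def using r A' C F assms(2)
    by (intro exI[of _ r] exI[of _ A] exI[of _ C] conjI allI ballI impI) auto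
qed

lemma analytic_at_cong:
  assumes "analytic_at E m n F p" "\<And>h. h \<in> E \<Longrightarrow> F (sadd p h) = G (sadd p h)"
  shows "analytic_at E m n G p"
  using assms unfolding analytic_at_def by simp

lemma mlin_bounded_lincomb:
  assumes A: "mlin_bounded E m n j A C" and B: "mlin_bounded E m n j B D"
  shows "mlin_bounded E m n j (\<lambda>hs k. complex_of_real \<alpha> * A hs k + complex_of_real \<beta> * B hs k) (\<bar>\<alpha>\<bar> * C + \<bar>\<beta>\<bar> * D)"
  unfolding mlin_bounded_def
proof (intro conjI allI impI)
  fix hs assume h: "\<forall>i<j. hs i \<in> E"
  have a: "A hs \<in> Hs n" "hnorm n (A hs) \<le> C * (\<Prod>i<j. hnorm m (hs i))"
    using mlin_bounded_mem[OF A h] mlin_bounded_bound[OF A h] by auto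
  have b: "B hs \<in> Hs n" "hnorm n (B hs) \<le> D * (\<Prod>i<j. hnorm m (hs i))"
    using mlin_bounded_mem[OF B h] mlin_bounded_bound[OF B h] by auto
  show "(\<lambda>k. complex_of_real \<alpha> * A hs k + complex_of_real \<beta> * B hs k) \<in> Hs n" by (rule Hs_lincomb[OF a(1) b(1)])
  have "hnorm n (\<lambda>k. complex_of_real \<alpha> * A hs k + complex_of_real \<beta> * B hs k)
      \<le> hnorm n (\<lambda>k. complex_of_real \<alpha> * A hs k) + hnorm n (\<lambda>k. complex_of_real \<beta> * B hs k)"
    using a(1) b(1) by (intro hnorm_add hfin_scale) (auto simp: Hs_iff)
  also have "\<dots> \<le> \<bar>\<alpha>\<bar> * (C * (\<Prod>i<j. hnorm m (hs i))) + \<bar>\<beta>\<bar> * (D * (\<Prod>i<j. hnorm m (hs i)))"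
    unfolding hnorm_scale norm_of_real by (intro add_mono mult_left_mono a b) auto
  finally show "hnorm n (\<lambda>k. complex_of_real \<alpha> * A hs k + complex_of_real \<beta> * B hs k)
      \<le> (\<bar>\<alpha>\<bar> * C + \<bar>\<beta>\<bar> * D) * (\<Prod>i<j. hnorm m (hs i))" by (simp add: algebra_simps)
next
  fix hs i x y a b assume h: "\<forall>l<j. hs l \<in> E" "i < j" "x \<in> E" "y \<in> E"
  have "A (hs(i := sadd (sscale a x) (sscale b y))) = sadd (sscale a (A (hs(i := x)))) (sscale b (A (hs(i := y))))"
    by (rule mlin_bounded_linear[OF A h])
  moreover have "B (hs(i := sadd (sscale a x) (sscale b y))) = sadd (sscale a (B (hs(i := x)))) (sscale b (B (hs(i := y))))"
    by (rule mlin_bounded_linear[OF B h])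
  ultimately show "(\<lambda>k. complex_of_real \<alpha> * A (hs(i := sadd (sscale a x) (sscale b y))) k
        + complex_of_real \<beta> * B (hs(i := sadd (sscale a x) (sscale b y))) k) =
      sadd (sscale a (\<lambda>k. complex_of_real \<alpha> * A (hs(i := x)) k + complex_of_real \<beta> * B (hs(i := x)) k))
        (sscale b (\<lambda>k. complex_of_real \<alpha> * A (hs(i := y)) k + complex_of_real \<beta> * B (hs(i := y)) k))"
    by (auto simp: sadd_def sscale_def algebra_simps)
next
  fix hs hs' :: "nat \<Rightarrow> fseq" assume h: "\<forall>i<j. hs i = hs' i"
  have "A hs = A hs'" by (rule mlin_bounded_cong[OF A h])
  moreover have "B hs = B hs'" by (rule mlin_bounded_cong[OF B h])
  ultimately show "(\<lambda>k. complex_of_real \<alpha> * A hs k + complex_of_real \<beta> * B hs k)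
      = (\<lambda>k. complex_of_real \<alpha> * A hs' k + complex_of_real \<beta> * B hs' k)" by simp
qed

lemma hfin_sum: "(\<And>j. hfin s (c j)) \<Longrightarrow> hfin s (\<lambda>k. \<Sum>j<(N::nat). c j k)"
  by (induction N) (auto intro!: hfin_add)

lemma analytic_at_lincomb:
  assumes F: "analytic_at E m n F p" and G: "analytic_at E m n G p"
    and mem: "\<And>h. h \<in> E \<Longrightarrow> F (sadd p h) \<in> Hs n" "\<And>h. h \<in> E \<Longrightarrow> G (sadd p h) \<in> Hs n"
  shows "analytic_at E m n (\<lambda>v k. complex_of_real \<alpha> * F v k + complex_of_real \<beta> * G v k) p"
proof -
  obtain r1 A C where r1: "r1 > 0" and A: "\<And>j. mlin_bounded E m n j (A j) (C j)"
    and C: "summable (\<lambda>j. C j * r1 ^ j)"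
    and FA: "\<And>h. h \<in> E \<Longrightarrow> hnorm m h < r1 \<Longrightarrow>
      (\<lambda>N. hnorm n (\<lambda>k. F (sadd p h) k - (\<Sum>j<N. A j (\<lambda>_. h) k))) \<longlonglongrightarrow> 0"
    using F unfolding analytic_at_def by blast
  obtain r2 B D where r2: "r2 > 0" and B: "\<And>j. mlin_bounded E m n j (B j) (D j)"
    and D: "summable (\<lambda>j. D j * r2 ^ j)"
    and GB: "\<And>h. h \<in> E \<Longrightarrow> hnorm m h < r2 \<Longrightarrow>
      (\<lambda>N. hnorm n (\<lambda>k. G (sadd p h) k - (\<Sum>j<N. B j (\<lambda>_. h) k))) \<longlonglongrightarrow> 0"
    using G unfolding analytic_at_def by blast
  \<comment> \<open>Strictly inside both radii, so that \<open>powser_inside\<close> gives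
    convergence of both majorants at this common radius.\<close>
  define r where "r = min r1 r2 / 2"
  have r: "r > 0" "r < r1" "r < r2" using r1 r2 by (auto simp: r_def)
  have sC: "summable (\<lambda>j. C j * r ^ j)" "summable (\<lambda>j. D j * r ^ j)"
    using powser_inside[OF C, of r] powser_inside[OF D, of r] r by auto
  show ?thesis
    unfolding analytic_at_def
  proof (intro exI conjI allI ballI impI)
    show "r > 0" by (rule r)
    show "mlin_bounded E m n j (\<lambda>hs k. complex_of_real \<alpha> * A j hs k + complex_of_real \<beta> * B j hs k)
        (\<bar>\<alpha>\<bar> * C j + \<bar>\<beta>\<bar> * D j)" for j by (rule mlin_bounded_lincomb[OF A B])
    have "summable (\<lambda>j. \<bar>\<alpha>\<bar> * (C j * r ^ j) + \<bar>\<beta>\<bar> * (D j * r ^ j))"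
      by (intro summable_add summable_mult sC)
    thus "summable (\<lambda>j. (\<bar>\<alpha>\<bar> * C j + \<bar>\<beta>\<bar> * D j) * r ^ j)" by (simp add: algebra_simps)
    fix h assume h: "h \<in> E" "hnorm m h < r"
    define x where "x N = (\<lambda>k. F (sadd p h) k - (\<Sum>j<N. A j (\<lambda>_. h) k))" for N
    define y where "y N = (\<lambda>k. G (sadd p h) k - (\<Sum>j<N. B j (\<lambda>_. h) k))" for N
    have AH: "A j (\<lambda>_. h) \<in> Hs n" and BH: "B j (\<lambda>_. h) \<in> Hs n" for j
      using mlin_bounded_mem[OF A[of j], of "\<lambda>_. h"] mlin_bounded_mem[OF B[of j], of "\<lambda>_. h"] h(1) by auto
    have x: "hfin n (x N)" and y: "hfin n (y N)" for N
      unfolding x_def y_def using mem[OF h(1)] AH BH by (auto simp: Hs_iff intro!: hfin_diff hfin_sum)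
    have x0: "(\<lambda>N. hnorm n (x N)) \<longlonglongrightarrow> 0" and y0: "(\<lambda>N. hnorm n (y N)) \<longlonglongrightarrow> 0"
      unfolding x_def y_def using h r by (auto intro!: FA GB)
    show "(\<lambda>N. hnorm n (\<lambda>k. complex_of_real \<alpha> * F (sadd p h) k + complex_of_real \<beta> * G (sadd p h) k
        - (\<Sum>j<N. complex_of_real \<alpha> * A j (\<lambda>_. h) k + complex_of_real \<beta> * B j (\<lambda>_. h) k))) \<longlonglongrightarrow> 0"
    proof (rule tendsto_sandwich[OF always_eventually always_eventually tendsto_const])
      have "(\<lambda>N. \<bar>\<alpha>\<bar> * hnorm n (x N) + \<bar>\<beta>\<bar> * hnorm n (y N)) \<longlonglongrightarrow> \<bar>\<alpha>\<bar> * 0 + \<bar>\<beta>\<bar> * 0"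
        by (intro tendsto_intros x0 y0)
      thus "(\<lambda>N. \<bar>\<alpha>\<bar> * hnorm n (x N) + \<bar>\<beta>\<bar> * hnorm n (y N)) \<longlonglongrightarrow> 0" by simp
      show "\<forall>N. hnorm n (\<lambda>k. complex_of_real \<alpha> * F (sadd p h) k + complex_of_real \<beta> * G (sadd p h) k
        - (\<Sum>j<N. complex_of_real \<alpha> * A j (\<lambda>_. h) k + complex_of_real \<beta> * B j (\<lambda>_. h) k))
        \<le> \<bar>\<alpha>\<bar> * hnorm n (x N) + \<bar>\<beta>\<bar> * hnorm n (y N)"
      proof
        fix N
        have eq: "(\<lambda>k. complex_of_real \<alpha> * F (sadd p h) k + complex_of_real \<beta> * G (sadd p h) k
          - (\<Sum>j<N. complex_of_real \<alpha> * A j (\<lambda>_. h) k + complex_of_real \<beta> * B j (\<lambda>_. h) k))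
          = (\<lambda>k. complex_of_real \<alpha> * x N k + complex_of_real \<beta> * y N k)"
          by (auto simp: x_def y_def sum.distrib sum_distrib_left algebra_simps)
        have "hnorm n (\<lambda>k. complex_of_real \<alpha> * x N k + complex_of_real \<beta> * y N k)
            \<le> hnorm n (\<lambda>k. complex_of_real \<alpha> * x N k) + hnorm n (\<lambda>k. complex_of_real \<beta> * y N k)"
          by (intro hnorm_add hfin_scale x y)
        thus "hnorm n (\<lambda>k. complex_of_real \<alpha> * F (sadd p h) k + complex_of_real \<beta> * G (sadd p h) k
          - (\<Sum>j<N. complex_of_real \<alpha> * A j (\<lambda>_. h) k + complex_of_real \<beta> * B j (\<lambda>_. h) k))
          \<le> \<bar>\<alpha>\<bar> * hnorm n (x N) + \<bar>\<beta>\<bar> * hnorm n (y N)" unfolding eq hnorm_scale norm_of_real .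
      qed
    qed simp
  qed
qed

text \<open>The Taylor series is T p + T h, with all higher forms zero, so any positive radius
  works.\<close>

lemma analytic_at_linear:
  assumes bd: "\<And>x. x \<in> E \<Longrightarrow> T x \<in> Hs n" "\<And>x. x \<in> E \<Longrightarrow> hnorm n (T x) \<le> K * hnorm m x"
    and lin: "\<And>x y a b. T (sadd (sscale a x) (sscale b y)) = sadd (sscale a (T x)) (sscale b (T y))"
    and p: "p \<in> E"
  shows "analytic_at E m n T p"
proof -
  define A where "A j hs = (if j = 0 then T p else if j = Suc 0 then T (hs 0) else (\<lambda>k. 0))" for j and hs :: "nat \<Rightarrow> fseq"
  define C where "C j = (if j = 0 then hnorm n (T p) else if j = Suc 0 then K else 0)" for j
  have "sscale 1 x = x" for x by (simp add: sscale_def)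
  with lin[of 1 _ 1] have add: "T (sadd x y) = sadd (T x) (T y)" for x y by metis
  have zero: "(\<lambda>k. 0) \<in> Hs n" by (simp add: Hs_iff real_seq_def)
  show ?thesis
    unfolding analytic_at_def
  proof (intro exI conjI allI ballI impI)
    show "(1::real) > 0" by simp
    show "mlin_bounded E m n j (A j) (C j)" for j
      unfolding mlin_bounded_def A_def C_def
      using bd p zero by (auto simp: lin) (auto simp: sadd_def sscale_def)
    have "(\<lambda>j. C j * 1 ^ j) sums (\<Sum>j<2. C j * 1 ^ j)" by (rule sums_finite) (auto simp: C_def)
    thus "summable (\<lambda>j. C j * 1 ^ j)" by (rule sums_summable)
    fix h
    \<comment> \<open>From two terms on, the partial sums are exact; hence the shift of the sequence
      by 2.\<close>
    have "(\<lambda>k. T (sadd p h) k - (\<Sum>j<N + 2. A j (\<lambda>_. h) k)) = (\<lambda>k. 0)" for N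
    proof -
      have *: "(\<Sum>j<N + 2. A j (\<lambda>_. h) k) = (\<Sum>j<2. A j (\<lambda>_. h) k)" for k
        by (rule sum.mono_neutral_right) (auto simp: A_def)
      show ?thesis unfolding * add by (auto simp: sadd_def A_def numeral_2_eq_2)
    qed
    hence "(\<lambda>N. hnorm n (\<lambda>k. T (sadd p h) k - (\<Sum>j<N + 2. A j (\<lambda>_. h) k))) \<longlonglongrightarrow> 0" by simp
    thus "(\<lambda>N. hnorm n (\<lambda>k. T (sadd p h) k - (\<Sum>j<N. A j (\<lambda>_. h) k))) \<longlonglongrightarrow> 0"
      by (rule LIMSEQ_offset)
  qed
qed

text \<open>By \<open>c_sh_eq\<close>, \<open>Psi_sh\<close> is a linear combination of
  \<open>antider\<close> and of ln \<open>expint a\<close> for a = 2 and a = -2, placed in the zero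
  mode.\<close>

lemma analytic_at_Psi_sh:
  assumes v: "v \<in> Hs m"
  shows "analytic_at (Hs m) m (m + 1) Psi_sh v"
proof -
  let ?l = "\<lambda>a v k. if k = (0::int) then complex_of_real (ln (expint a v)) else 0"
  have T: "analytic_at (Hs m) m (m + 1) antider v"
    by (rule analytic_at_linear[OF antider_Hs, where K=1])
       (use hnorm_antider v in \<open>auto simp: sadd_def sscale_def antider_lincomb\<close>)
  have "analytic_at (Hs m) m (m + 1)
      (\<lambda>v k. complex_of_real (1/2) * ?l (-2) v k + complex_of_real (- 1/2) * ?l 2 v k) v" (is "analytic_at _ _ _ ?c v")
    by (intro analytic_at_lincomb analytic_at_ln_expint v Hs_const)
  hence "analytic_at (Hs m) m (m + 1) (\<lambda>v k. complex_of_real 2 * antider v k + complex_of_real 1 * ?c v k) v"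
    by (rule analytic_at_lincomb[OF T]) (intro antider_Hs sadd_Hs v Hs_lincomb Hs_const; assumption)+
  thus ?thesis
  proof (rule analytic_at_cong)
    fix h assume "h \<in> Hs m"
    from c_sh_eq[OF sadd_Hs[OF v this]]
    show "(\<lambda>k. complex_of_real 2 * antider (sadd v h) k + complex_of_real 1 * ?c (sadd v h) k) = Psi_sh (sadd v h)"
      by (auto simp: Psi_sh_def diff_divide_distrib)
  qed
qed

lemma analytic_diffeo_onto_Psi_sh: "analytic_diffeo_onto (Hs0 m) m (m + 1) Psi_sh (M_sh (m + 1))"
proof -
  define G :: "fseq \<Rightarrow> fseq" where "G u = (\<lambda>k. dx u k / 2)" for u
  have G: "G u \<in> Hs m" "hnorm m (G u) \<le> pi * hnorm (m + 1) u" if "u \<in> Hs (m + 1)" for u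
  proof -
    have "dx u \<in> Hs m" using dx_Hs0[OF that] by (rule Hs0_Hs)
    from Hs_lincomb[OF this this, of "1/2" 0] show "G u \<in> Hs m" by (simp add: G_def)
    have "hfin (m + 1) u" using that by (simp add: Hs_iff)
    from hnorm_dx[OF this] hnorm_scale[of m "1/2" "dx u"] show "hnorm m (G u) \<le> pi * hnorm (m + 1) u"
      by (simp add: G_def)
  qed
  have an: "analytic_at (Hs (m + 1)) (m + 1) m G q" if "q \<in> Hs (m + 1)" for q
    by (rule analytic_at_linear[OF G _ that])
       (auto simp: G_def sadd_def sscale_def dx_def algebra_simps add_divide_distrib)
  have inv: "G u = the_inv_into (Hs0 m) Psi_sh u" if "u \<in> M_sh (m + 1)" for u
    using Psi_sh_dx_half[OF that] bij_betw_Psi_sh[of m]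
    by (auto simp: G_def bij_betw_def intro!: the_inv_into_f_eq[symmetric])
  have sub: "M_sh (m + 1) \<subseteq> Hs (m + 1)" by (auto simp: M_sh_def)
  have op: "hopen (m + 1) (Hs (m + 1)) (Hs (m + 1))"
    unfolding hopen_def by (auto intro: exI[of _ 1])
  have "analytic_at (Hs0 m) m (m + 1) Psi_sh v" if "v \<in> Hs0 m" for v
    by (rule analytic_at_subset[OF analytic_at_Psi_sh[OF Hs0_Hs[OF that]]]) (auto simp: Hs0_def)
  thus ?thesis
    unfolding analytic_diffeo_onto_def using bij_betw_Psi_sh sub op an inv
    by (intro conjI exI[of _ "Hs (m + 1)"] exI[of _ G]) auto
qed

theorem theorem1p1:
  fixes m :: nat
  shows "(\<forall>v\<in>Hs0 m. intT (\<lambda>x. cosh (2 * fseries (antider v) x)) > 0 \<and>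
            \<bar>intT (\<lambda>x. sinh (2 * fseries (antider v) x))
              / intT (\<lambda>x. cosh (2 * fseries (antider v) x))\<bar> < 1)
       \<and> analytic_diffeo_onto (Hs0 m) m (m + 1) Psi_sh (M_sh (m + 1))
       \<and> (\<forall>v a b. a < b \<longrightarrow> C1_curve (Hs0 m) m v a b \<longrightarrow>
            (solves_vsh m v a b \<longleftrightarrow> solves_SG m (\<lambda>t. Psi_sh (v t)) a b))
       \<and> (\<forall>v\<in>Hs0 m. X_sh v \<in> Hs0 (m + 1))
       \<and> (\<forall>v\<in>Hs0 m. \<exists>g\<in>Hs 1. has_L2grad (Hs0 m) m H_sh v g \<and> dx g = X_sh v)"
proof (intro conjI ballI allI impI)
  fix v assume "v \<in> Hs0 m"
  hence v: "v \<in> Hs m" by (rule Hs0_Hs)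
  have pos: "expint 2 v > 0" "expint (-2) v > 0" by (intro expint_pos[OF v])+
  thus "intT (\<lambda>x. cosh (2 * fseries (antider v) x)) > 0"
    by (simp add: intT_cosh_antider[OF v])
  have "\<bar>(expint 2 v - expint (-2) v) / 2\<bar> < (expint 2 v + expint (-2) v) / 2"
    using pos by (simp add: abs_less_iff)
  thus "\<bar>intT (\<lambda>x. sinh (2 * fseries (antider v) x)) / intT (\<lambda>x. cosh (2 * fseries (antider v) x))\<bar> < 1"
    unfolding intT_sinh_antider[OF v] intT_cosh_antider[OF v] abs_divide
    using pos by (simp add: divide_less_eq_1)
  show "X_sh v \<in> Hs0 (m + 1)" by (rule X_sh_Hs0[OF v])
  \<comment> \<open>The gradient is the antiderivative of \<open>X_sh v\<close>. It lies in order m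
    + 2, hence in H^1, and the vanishing mean of \<open>X_sh v\<close> lets \<open>dx\<close> undo
    \<open>antider\<close>.\<close>
  show "\<exists>g\<in>Hs 1. has_L2grad (Hs0 m) m H_sh v g \<and> dx g = X_sh v"
  proof (intro bexI conjI)
    show "has_L2grad (Hs0 m) m H_sh v (antider (X_sh v))"
      using has_L2grad_H_sh[OF v] unfolding has_L2grad_def Hs0_def by blast
    show "dx (antider (X_sh v)) = X_sh v"
      using X_sh_Hs0[OF v] by (intro dx_antider) (simp add: Hs0_def)
    show "antider (X_sh v) \<in> Hs 1"
      using Hs_order_mono[OF antider_Hs[OF Hs0_Hs[OF X_sh_Hs0[OF v]]], of 1] by simp
  qed
next
  fix v and a b :: real assume "C1_curve (Hs0 m) m v a b"
  thus "solves_vsh m v a b \<longleftrightarrow> solves_SG m (\<lambda>t. Psi_sh (v t)) a b"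
    using solves_vsh_imp_solves_SG solves_SG_imp_solves_vsh unfolding C1_curve_def by blast
qed (rule analytic_diffeo_onto_Psi_sh)

end
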